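(* There exist $T>0$, $w\in W^{1,2}(-T,T)$, and a continuous Lagrangian $L\colon[-T,T]\times\mathbb{R}\times\mathbb{R}\to[0,\infty)$, $L=L(t,y,p)$, superlinear and satisfying $L_{pp}\ge2>0$, such that $w$ is a minimizer of $\mathscr{L}$ over $\mathscr{A}_{w(-T),w(T)}$ and $0\le\mathscr{L}(w)<\infty$, but $\mathscr{L}(w+u)=\infty$ for all non-zero $u\in W^{1,\infty}_0(-T,T)$.
   Context: $\mathscr{L}(u)=\int_{-T}^TL(t,u(t),u'(t))\,dt\in[0,\infty]$ for $u\in W^{1,1}(-T,T)$ (real-valued functions, identified with their absolutely continuous representatives on $[-T,T]$). $\mathscr{A}_{A,B}=\{u\in W^{1,1}(-T,T):u(-T)=A,\ u(T)=B\}$. A minimizer of $\mathscr{L}$ over $\mathscr{A}_{A,B}$ is $v\in\mathscr{A}_{A,B}$ with $\mathscr{L}(v)\le\mathscr{L}(u)$ for all $u\in\mathscr{A}_{A,B}$. $L$ is superlinear if there is $\omega\colon\mathbb{R}\to\mathbb{R}$ with $\omega(|p|)/|p|\to\infty$ as $|p|\to\infty$ and $L(t,y,p)\ge\omega(|p|)$ for all $(t,y,p)$. $L_{pp}$ denotes the second partial derivative of $L$ in $p$. $W_0^{1,\infty}(-T,T)$ is the space of Lipschitz functions on $[-T,T]$ vanishing at $\pm T$. *)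

theory Defs
  imports "HOL-Analysis.Analysis"
begin

definition Lp_on :: "real \<Rightarrow> real set \<Rightarrow> (real \<Rightarrow> real) \<Rightarrow> bool" where
  "Lp_on p S f \<longleftrightarrow>
     set_borel_measurable lebesgue S f \<and> set_integrable lebesgue S (\<lambda>x. \<bar>f x\<bar> powr p)"

(* C^1 functions with compact support in the open interval (a,b) *)
definition test_function :: "real \<Rightarrow> real \<Rightarrow> (real \<Rightarrow> real) \<Rightarrow> bool" where
  "test_function a b \<phi> \<longleftrightarrow>
     (\<forall>x. \<phi> differentiable (at x)) \<and> continuous_on UNIV (deriv \<phi>) \<and>
     (\<exists>c d. a < c \<and> d < b \<and> (\<forall>x. x \<notin> {c..d} \<longrightarrow> \<phi> x = 0))"

definition weak_derivative ::
    "real \<Rightarrow> real \<Rightarrow> (real \<Rightarrow> real) \<Rightarrow> (real \<Rightarrow> real) \<Rightarrow> bool" where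
  "weak_derivative a b u v \<longleftrightarrow>
     Lp_on 1 {a<..<b} v \<and>
     (\<forall>\<phi>. test_function a b \<phi> \<longrightarrow>
        (LINT x:{a<..<b}|lebesgue. u x * deriv \<phi> x)
          = - (LINT x:{a<..<b}|lebesgue. v x * \<phi> x))"

(* W^{1,p}(a,b) for 1 \<le> p < \<infinity>. Continuity on [a,b] selects, in each class of almost
   everywhere equal functions, the absolutely continuous representative.
   Values outside [a,b] are irrelevant. *)
definition sobolev :: "real \<Rightarrow> real \<Rightarrow> real \<Rightarrow> (real \<Rightarrow> real) set" where
  "sobolev p a b =
     {u. continuous_on {a..b} u \<and> Lp_on p {a<..<b} u \<and>
         (\<exists>v. weak_derivative a b u v \<and> Lp_on p {a<..<b} v)}"

(* W_0^{1,\<infinity>}(a,b) *)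
definition lipschitz_zero :: "real \<Rightarrow> real \<Rightarrow> (real \<Rightarrow> real) set" where
  "lipschitz_zero a b = {u. (\<exists>C. C-lipschitz_on {a..b} u) \<and> u a = 0 \<and> u b = 0}"

(* Weak derivatives are unique up to null sets, so the choice does not affect
   integrals. *)
definition wderiv :: "real \<Rightarrow> real \<Rightarrow> (real \<Rightarrow> real) \<Rightarrow> real \<Rightarrow> real" where
  "wderiv a b u = (SOME v. weak_derivative a b u v)"

(* Used only for L that is nonnegative on [-T,T], where ennreal loses nothing. *)
definition energy ::
    "(real \<Rightarrow> real \<Rightarrow> real \<Rightarrow> real) \<Rightarrow> real \<Rightarrow> (real \<Rightarrow> real) \<Rightarrow> ennreal" where
  "energy L T u =
     (\<integral>\<^sup>+t\<in>{-T<..<T}. ennreal (L t (u t) (wderiv (-T) T u t)) \<partial>lebesgue)"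

definition admissible :: "real \<Rightarrow> real \<Rightarrow> real \<Rightarrow> (real \<Rightarrow> real) set" where
  "admissible T A B = {u \<in> sobolev 1 (-T) T. u (-T) = A \<and> u T = B}"

definition minimizer_over ::
    "(real \<Rightarrow> real \<Rightarrow> real \<Rightarrow> real) \<Rightarrow> real \<Rightarrow> real \<Rightarrow> real \<Rightarrow> (real \<Rightarrow> real) \<Rightarrow> bool" where
  "minimizer_over L T A B v \<longleftrightarrow>
     v \<in> admissible T A B \<and> (\<forall>u \<in> admissible T A B. energy L T v \<le> energy L T u)"

definition superlinear :: "(real \<Rightarrow> real \<Rightarrow> real \<Rightarrow> real) \<Rightarrow> real \<Rightarrow> bool" where
  "superlinear L T \<longleftrightarrow>
     (\<exists>\<omega> :: real \<Rightarrow> real.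
        filterlim (\<lambda>p::real. \<omega> \<bar>p\<bar> / \<bar>p\<bar>) at_top at_infinity \<and>
        (\<forall>t\<in>{-T..T}. \<forall>y p. L t y p \<ge> \<omega> \<bar>p\<bar>))"

(* L_pp exists everywhere and is at least c *)
definition Lpp_at_least :: "(real \<Rightarrow> real \<Rightarrow> real \<Rightarrow> real) \<Rightarrow> real \<Rightarrow> real \<Rightarrow> bool" where
  "Lpp_at_least L T c \<longleftrightarrow>
     (\<forall>t\<in>{-T..T}. \<forall>y p.
        L t y differentiable (at p) \<and> deriv (L t y) differentiable (at p) \<and>
        deriv (deriv (L t y)) p \<ge> c)"

end

theory Submission
  imports Defs "HOL-Real_Asymp.Real_Asymp"
begin

text \<open>Write \<open>g\<close> for the derivative of the minimizer \<open>w\<close>. The Lagrangian is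
\<open>L t y p = p\<^sup>2 + \<bar>y - w t\<bar> * exp (exp (p\<^sup>2)) + \<Phi> (y - w t)\<close> on \<open>[-1, 1]\<close>, with a continuous
penalty \<open>\<Phi> \<ge> 0\<close> and \<open>\<Phi> 0 = 0\<close>. Along \<open>y = w t\<close> only the quadratic term is left, so \<open>w\<close> has finite
energy as soon as \<open>g\<close> is square integrable. Off the graph of \<open>w\<close> the second term takes over: if
\<open>exp (exp ((g - C)\<^sup>2))\<close> fails to be integrable on every interval and for every \<open>C\<close>, then adding to
\<open>w\<close> any nonzero Lipschitz function, whose slope is bounded, makes the energy infinite.

Both demands on \<open>g\<close> are met by a sum of smooth spikes. Spike \<open>j\<close> has height \<open>1 / (j + 1)\<close> and the tiny
width \<open>(1/2) ^ (j * (j + 9))\<close>, and every rational number is the centre of a set of spikes of positive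
density in \<open>j\<close>. The widths make \<open>g\<close> square integrable; near each rational the heights add up to a
multiple of a harmonic series, so \<open>g\<close> grows there like an iterated logarithm of the distance, which
two exponentials turn into a non-integrable singularity (\<open>nn_integral_blow_up\<close>).

The point is minimality. For a competitor \<open>w + v\<close> with \<open>v\<close> vanishing at the end points and \<open>f = v'\<close>, the
energies differ at least by the integral of \<open>2 * g * f + f\<^sup>2 + \<Phi> v\<close>, which has to be nonnegative.
The first term is linear in \<open>g\<close>, so each spike may be treated alone, provided that spike \<open>j\<close> uses only a
share \<open>\<epsilon>\<^sub>j\<close> of the quadratic term and a part \<open>\<phi>\<^sub>j\<close> of the penalty. For a spike of height \<open>a\<close>, width
\<open>\<delta>\<close> and share \<open>\<epsilon>\<close> (\<open>spike_compensated\<close>) put \<open>s = 3 * a * \<delta> / \<epsilon>\<close>. If \<open>\<bar>v\<bar> \<le> s\<close> on the spike, an integration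
by parts moves the derivative to the spike, and the penalty \<open>4 * a / \<delta> * \<bar>v\<bar>\<close> pays for it. Otherwise \<open>\<bar>v\<bar>\<close>
has to climb from \<open>0\<close> above \<open>s\<close>, and the climb from \<open>s / 2\<close> to \<open>s\<close> alone costs more, in the sum of the quadratic
term and the penalty, than the spike can ever gain. The penalty can therefore vanish for
\<open>\<bar>y\<bar> \<ge> 2 * s\<close>; its maximum is of order \<open>a\<^sup>2 / \<epsilon>\<close>.

With \<open>a = 1 / (j + 1)\<close> and \<open>\<epsilon>\<^sub>j\<close> of order \<open>j powr (-3/2)\<close> the shares are summable and the maxima of the
\<open>\<phi>\<^sub>j\<close> tend to \<open>0\<close>, although their sum diverges, as it must when the heights are not summable. The sum of the \<open>\<phi>\<^sub>j\<close> is nevertheless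
continuous: the widths decrease so fast that at each point all but one of the nonzero \<open>\<phi>\<^sub>j\<close> are below
\<open>(1/2) ^ j\<close> (\<open>spike_penalty_separated\<close>).

The weak formulation enters through one equivalence: a continuous function has weak derivative \<open>f\<close> on an
interval iff it is a primitive of \<open>f\<close>.\<close>

section \<open>Measures and integrals on the line\<close>

text \<open>The sum of two measures is again a measure, and it is determined by its values on half-open intervals.
In the applications one summand is the slack in an inequality, on intervals, between the other summand and \<open>R\<close>; the conclusion
carries this inequality over to all Borel sets.\<close>

lemma emeasure_add_eqI_Ioc:
  fixes M N R :: "real measure"
  assumes M: "sets M = sets borel" and N: "sets N = sets borel" and R: "sets R = sets borel"
    and eq: "\<And>a b. a \<le> b \<Longrightarrow> emeasure M {a<..b} + emeasure N {a<..b} = emeasure R {a<..b}"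
    and fin: "\<And>a b. emeasure R {a<..b} < \<infinity>"
    and A: "A \<in> sets borel"
  shows "emeasure M A + emeasure N A = emeasure R A"
proof -
  define S where "S = measure_of UNIV (sets borel) (\<lambda>A. emeasure M A + emeasure N A)"
  have S: "emeasure S B = emeasure M B + emeasure N B" if "B \<in> sets borel" for B
    unfolding S_def
  proof (rule emeasure_measure_of_sigma)
    show "sigma_algebra UNIV (sets (borel :: real measure))"
      using sets.sigma_algebra_axioms[of "borel :: real measure"] by simp
    show "positive (sets borel) (\<lambda>A. emeasure M A + emeasure N A)"
      by (simp add: positive_def)
    show "countably_additive (sets borel) (\<lambda>A. emeasure M A + emeasure N A)"
    proof (rule countably_additiveI)
      fix F :: "nat \<Rightarrow> real set"
      assume F: "range F \<subseteq> sets borel" "disjoint_family F" "\<Union> (range F) \<in> sets borel"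
      have "(\<Sum>i. emeasure M (F i)) = emeasure M (\<Union> (range F))"
        "(\<Sum>i. emeasure N (F i)) = emeasure N (\<Union> (range F))"
        using F M N by (auto intro!: suminf_emeasure)
      then show "(\<Sum>i. emeasure M (F i) + emeasure N (F i))
          = emeasure M (\<Union> (range F)) + emeasure N (\<Union> (range F))"
        by (simp add: suminf_add[symmetric])
    qed
  qed (use that in auto)
  have setsS: "sets S = sets borel"
    unfolding S_def using sets.sigma_sets_eq[of "borel :: real measure"] by simp
  have "S = R"
  proof (rule measure_eqI_generator_eq[where E="range (\<lambda>(a, b). {a<..b::real})" and \<Omega>=UNIV
        and A="\<lambda>n::nat. {- real n<..real n}"])
    show "Int_stable (range (\<lambda>(a, b). {a<..b::real}))"
      unfolding Int_stable_def
    proof safe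
      fix a b c d :: real
      have "{a<..b} \<inter> {c<..d} = {max a c<..min b d}" by auto
      then show "{a<..b} \<inter> {c<..d} \<in> range (\<lambda>(a, b). {a<..b})" by auto
    qed
    show "sets S = sigma_sets UNIV (range (\<lambda>(a, b). {a<..b::real}))"
      "sets R = sigma_sets UNIV (range (\<lambda>(a, b). {a<..b::real}))"
      unfolding setsS R borel_sigma_sets_Ioc by (simp_all add: sets_measure_of)
    fix X assume "X \<in> range (\<lambda>(a, b). {a<..b::real})"
    then obtain a b where X: "X = {a<..b}" by auto
    show "emeasure S X = emeasure R X"
      unfolding X using S[of "{a<..b}"] eq[of a b] by (cases "a \<le> b") auto
  next
    show "(\<Union>n. {- real n<..real n}) = UNIV"
    proof safe
      fix x :: real
      obtain n where "\<bar>x\<bar> < real n" using reals_Archimedean2 by blast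
      then show "x \<in> (\<Union>n. {- real n<..real n})" by (auto intro!: exI[of _ n])
    qed auto
    fix n :: nat
    show "emeasure S {- real n<..real n} \<noteq> \<infinity>"
      using S[of "{- real n<..real n}"] eq[of "- real n" "real n"] fin[of "- real n" "real n"] by auto
  qed (auto)
  then show ?thesis using S[OF A] by simp
qed

lemma isCont_integral_atMost:
  fixes h :: "real \<Rightarrow> real"
  assumes f: "integrable lborel h"
  shows "isCont (\<lambda>x. LINT t:{..x}|lborel. h t) x"
proof (subst continuous_at_sequentially, intro allI impI)
  fix X assume X: "X \<longlonglongrightarrow> x"
  show "((\<lambda>x. LINT t:{..x}|lborel. h t) \<circ> X) \<longlonglongrightarrow> (LINT t:{..x}|lborel. h t)"
    unfolding set_lebesgue_integral_def o_def
  proof (rule integral_dominated_convergence[where w="\<lambda>t. \<bar>h t\<bar>"])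
    show "AE t in lborel. (\<lambda>i. indicator {..X i} t *\<^sub>R h t) \<longlonglongrightarrow> indicator {..x} t *\<^sub>R h t"
      using AE_lborel_singleton[of x]
    proof eventually_elim
      case (elim t)
      have "\<forall>\<^sub>F i in sequentially. indicator {..X i} t *\<^sub>R h t = indicator {..x} t *\<^sub>R h t"
      proof (cases "t < x")
        case True
        then have "\<forall>\<^sub>F i in sequentially. t < X i" using X order_tendstoD(1) by blast
        then show ?thesis by eventually_elim (use True in auto)
      next
        case False
        then have "x < t" using elim by auto
        then have "\<forall>\<^sub>F i in sequentially. X i < t" using X order_tendstoD(2) by blast
        then show ?thesis by eventually_elim (use \<open>x < t\<close> in auto)
      qed
      then show ?case by (rule tendsto_eventually)
    qed
  qed (use f in \<open>auto split: split_indicator\<close>)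
qed

text \<open>The indefinite integral \<open>F\<close> of \<open>f\<close> is nondecreasing, hence generates an interval measure, and this measure plus the one with
density \<open>-f\<close> (negative part) is the one with density \<open>f\<close> (positive part). On the set \<open>{x. f x < 0}\<close> the latter is zero,
so the negative part vanishes there as well.\<close>

lemma AE_nonneg_if_integral_Ioc_nonneg:
  fixes f :: "real \<Rightarrow> real"
  assumes f: "integrable lborel f"
    and nn: "\<And>p q. p \<le> q \<Longrightarrow> 0 \<le> (LINT x:{p<..q}|lborel. f x)"
  shows "AE x in lborel. 0 \<le> f x"
proof -
  have si: "set_integrable lborel S f" if "S \<in> sets borel" for S
    using f that integrable_mult_indicator[of S lborel f] by (simp add: set_integrable_def)
  define F where "F x = (LINT t:{..x}|lborel. f t)" for x
  have F_diff: "F q - F p = (LINT x:{p<..q}|lborel. f x)" if "p \<le> q" for p q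
  proof -
    have "{..q} = {..p} \<union> {p<..q}" using that by auto
    then have "F q = F p + (LINT x:{p<..q}|lborel. f x)"
      unfolding F_def by (subst set_integral_Un[symmetric]) (auto intro: si)
    then show ?thesis by simp
  qed
  have cont: "isCont F x" for x unfolding F_def by (rule isCont_integral_atMost[OF f])
  have mono: "F p \<le> F q" if "p \<le> q" for p q
    using F_diff[OF that] nn[OF that] by simp
  define K where "K = interval_measure F"
  define M where "M = density lborel (\<lambda>x. ennreal (- f x))"
  define R where "R = density lborel (\<lambda>x. ennreal (f x))"
  have [measurable]: "f \<in> borel_measurable borel" using f by auto
  define A where "A = {x. f x < 0}"
  have A: "A \<in> sets borel" unfolding A_def by measurable
  have "emeasure K A + emeasure M A = emeasure R A"
  proof (rule emeasure_add_eqI_Ioc[OF _ _ _ _ _ A])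
    fix a b :: real
    have si': "integrable lborel (\<lambda>x. indicator {a<..b} x * f x)"
      using si[of "{a<..b}"] by (simp add: set_integrable_def)
    have R: "emeasure R {a<..b} = (\<integral>\<^sup>+x. ennreal (indicator {a<..b} x * f x) \<partial>lborel)"
      unfolding R_def by (subst emeasure_density) (auto intro!: nn_integral_cong split: split_indicator)
    have M: "emeasure M {a<..b} = (\<integral>\<^sup>+x. ennreal (- (indicator {a<..b} x * f x)) \<partial>lborel)"
      unfolding M_def by (subst emeasure_density) (auto intro!: nn_integral_cong split: split_indicator)
    have fin: "emeasure R {a<..b} < \<infinity>" "emeasure M {a<..b} < \<infinity>"
      unfolding R M using si' by (auto simp: real_integrable_def top.not_eq_extremum)
    then show "emeasure R {a<..b} < \<infinity>" by simp
    assume ab: "a \<le> b"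
    have "emeasure K {a<..b} = ennreal (F b - F a)"
      unfolding K_def using ab mono cont
      by (subst emeasure_interval_measure_Ioc) (auto intro: continuous_at_imp_continuous_at_within)
    moreover have "F b - F a = enn2real (emeasure R {a<..b}) - enn2real (emeasure M {a<..b})"
      unfolding F_diff[OF ab] set_lebesgue_integral_def R M
      using real_lebesgue_integral_def[OF si'] by simp
    moreover have "0 \<le> F b - F a" using mono[OF ab] by simp
    ultimately show "emeasure K {a<..b} + emeasure M {a<..b} = emeasure R {a<..b}"
      using fin by (cases "emeasure R {a<..b}"; cases "emeasure M {a<..b}")
        (auto simp flip: ennreal_plus)
  qed (auto simp: K_def M_def R_def)
  moreover have "emeasure R A = 0"
    unfolding R_def using A
    by (subst emeasure_density) (auto simp: A_def nn_integral_0_iff_AE ennreal_neg split: split_indicator)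
  ultimately have "emeasure M A = 0" by simp
  then have "AE x in lborel. ennreal (- f x) * indicator A x = 0"
    unfolding M_def using A by (subst (asm) emeasure_density) (auto simp: nn_integral_0_iff_AE)
  then show ?thesis
    by eventually_elim (auto simp: A_def split: split_indicator_asm)
qed

section \<open>Weak derivatives and primitives\<close>

text \<open>Absolute continuity of \<open>u\<close> on \<open>[a, b]\<close> with derivative \<open>f\<close>. Only the values of \<open>f\<close> on the open interval matter, as for
weak derivatives.\<close>

definition is_primitive :: "real \<Rightarrow> real \<Rightarrow> (real \<Rightarrow> real) \<Rightarrow> (real \<Rightarrow> real) \<Rightarrow> bool" where
  "is_primitive a b u f \<longleftrightarrow> set_integrable lebesgue {a<..<b} f \<and>
     (\<forall>x\<in>{a..b}. u x = u a + (LINT t:{a<..<x}|lebesgue. f t))"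

text \<open>Product measures and interval measures live on the Borel sets, whereas weak derivatives are only
Lebesgue measurable. The next lemmas pass from one to the other.\<close>

lemma borel_representative:
  fixes f :: "real \<Rightarrow> real"
  assumes f: "set_integrable lebesgue S f" and S: "S \<in> sets borel"
  obtains h where "integrable lborel h" "\<And>x. x \<notin> S \<Longrightarrow> h x = 0"
    "AE x in lborel. h x = indicator S x * f x"
proof -
  have fi: "integrable lebesgue (\<lambda>x. indicator S x * f x)"
    using f by (simp add: set_integrable_def)
  then obtain g where g[measurable]: "g \<in> borel_measurable lborel"
    and ae: "AE x in lborel. indicator S x * f x = g x"
    using completion_ex_borel_measurable_real[of "\<lambda>x. indicator S x * f x" lborel] by auto
  define h where "h x = indicator S x * g x" for x
  have h[measurable]: "h \<in> borel_measurable lborel" unfolding h_def using S by measurable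
  have ae': "AE x in lborel. h x = indicator S x * f x"
    using ae by eventually_elim (auto simp: h_def split: split_indicator_asm)
  have "integrable lebesgue h"
    using fi by (rule integrable_cong_AE_imp)
      (use AE_completion[OF ae'] in \<open>auto intro: measurable_completion\<close>)
  then have "integrable lborel h" by (simp add: integrable_completion)
  then show ?thesis using that ae' by (simp add: h_def)
qed

lemma borel_measurable_lebesgue_AE:
  assumes g: "g \<in> borel_measurable lebesgue" and ae: "AE x in lebesgue. g x = f x"
  shows "f \<in> borel_measurable lebesgue"
proof (rule measurableI)
  fix A :: "'b set" assume A: "A \<in> sets borel"
  have "g -` A \<in> sets lebesgue" using measurable_sets[OF g A] by simp
  then have "f -` A \<in> sets lebesgue"
  proof (rule completion.in_sets_AE[rotated])
    show "AE x in lebesgue. x \<in> g -` A \<longleftrightarrow> x \<in> f -` A"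
      using ae by eventually_elim simp
  qed simp
  then show "f -` A \<inter> space lebesgue \<in> sets lebesgue" by simp
qed simp

lemma set_integral_lebesgue_eq_lborel:
  fixes f :: "real \<Rightarrow> real"
  assumes h: "integrable lborel h" and ae: "AE x in lborel. indicator S x * h x = indicator S x * f x"
    and S: "S \<in> sets borel"
  shows "set_integrable lebesgue S f" "(LINT x:S|lebesgue. f x) = (LINT x:S|lborel. h x)"
proof -
  have hi: "integrable lborel (\<lambda>x. indicator S x * h x)"
    using integrable_mult_indicator[of S lborel h] S h by simp
  then have hi': "integrable lebesgue (\<lambda>x. indicator S x * h x)"
    by (subst integrable_completion) auto
  have fm: "(\<lambda>x. indicator S x * f x) \<in> borel_measurable lebesgue"
    by (rule borel_measurable_lebesgue_AE[OF borel_measurable_integrable[OF hi'] AE_completion[OF ae]])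
  show "set_integrable lebesgue S f"
    using integrable_cong_AE_imp[OF hi' fm AE_completion[OF ae]]
    by (simp add: set_integrable_def)
  have "(LINT x:S|lebesgue. f x) = (\<integral>x. indicator S x * h x \<partial>lebesgue)"
    unfolding set_lebesgue_integral_def real_scaleR_def
    by (rule integral_cong_AE[symmetric, OF borel_measurable_integrable[OF hi'] fm AE_completion[OF ae]])
  then show "(LINT x:S|lebesgue. f x) = (LINT x:S|lborel. h x)"
    unfolding set_lebesgue_integral_def using hi by (subst (asm) integral_completion) auto
qed

lemma is_primitive_iff_borel:
  assumes h: "integrable lborel h" and h0: "\<And>x. x \<notin> {a<..<b} \<Longrightarrow> h x = 0"
    and ae: "AE x in lborel. h x = indicator {a<..<b} x * f x"
  shows "is_primitive a b u f \<longleftrightarrow> (\<forall>x\<in>{a..b}. u x = u a + (LINT t:{..x}|lborel. h t))"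
proof -
  have ae1: "AE t in lborel. indicator {a<..<b} t * h t = indicator {a<..<b} t * f t"
    using ae by eventually_elim (auto split: split_indicator)
  have "(LINT t:{a<..<x}|lebesgue. f t) = (LINT t:{..x}|lborel. h t)" if "x \<in> {a..b}" for x
  proof -
    have "(LINT t:{a<..<x}|lebesgue. f t) = (LINT t:{a<..<x}|lborel. h t)"
    proof (rule set_integral_lebesgue_eq_lborel(2)[OF h])
      show "AE t in lborel. indicator {a<..<x} t * h t = indicator {a<..<x} t * f t"
        using ae by eventually_elim (use that in \<open>auto split: split_indicator\<close>)
    qed simp
    also have "\<dots> = (LINT t:{..x}|lborel. h t)"
      unfolding set_lebesgue_integral_def
    proof (rule integral_cong_AE)
      show "AE t in lborel. indicator {a<..<x} t *\<^sub>R h t = indicator {..x} t *\<^sub>R h t"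
        using AE_lborel_singleton[of x]
        by eventually_elim (use that h0 in \<open>auto split: split_indicator\<close>)
    qed (use h in auto)
    finally show ?thesis .
  qed
  then show ?thesis
    unfolding is_primitive_def
    using set_integral_lebesgue_eq_lborel(1)[OF h ae1] by auto
qed

lemma is_primitive_borel_representative:
  assumes "is_primitive a b u f"
  obtains h where "integrable lborel h" "\<And>x. x \<notin> {a<..<b} \<Longrightarrow> h x = 0"
    "AE x in lborel. h x = indicator {a<..<b} x * f x"
    "\<And>x. x \<in> {a..b} \<Longrightarrow> u x = u a + (LINT t:{..x}|lborel. h t)"
proof -
  have "set_integrable lebesgue {a<..<b} f" using assms by (simp add: is_primitive_def)
  then obtain h where h: "integrable lborel h" "\<And>x. x \<notin> {a<..<b} \<Longrightarrow> h x = 0"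
    "AE x in lborel. h x = indicator {a<..<b} x * f x"
    by (rule borel_representative) auto
  with is_primitive_iff_borel[OF h] assms that[OF h] show ?thesis by blast
qed

lemma is_primitive_continuous:
  assumes "is_primitive a b u f"
  shows "continuous_on {a..b} u"
proof -
  obtain h where h: "integrable lborel h" "\<And>x. x \<notin> {a<..<b} \<Longrightarrow> h x = 0"
    "AE x in lborel. h x = indicator {a<..<b} x * f x"
    and u: "\<And>x. x \<in> {a..b} \<Longrightarrow> u x = u a + (LINT t:{..x}|lborel. h t)"
    by (rule is_primitive_borel_representative[OF assms]) (rule that)
  have "continuous_on {a..b} (\<lambda>x. u a + (LINT t:{..x}|lborel. h t))"
    using isCont_integral_atMost[OF h(1)] by (intro continuous_intros continuous_at_imp_continuous_on) auto
  then show ?thesis by (rule continuous_on_eq) (rule u[symmetric])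
qed

text \<open>Two densities with the same primitive have equal integrals over all intervals, so their difference and its
negative are both nonnegative almost everywhere.\<close>

lemma is_primitive_AE_unique:
  assumes ab: "a \<le> b" and f: "is_primitive a b u f" and g: "is_primitive a b u g"
  shows "AE x in lborel. x \<in> {a<..<b} \<longrightarrow> f x = g x"
proof -
  have *: "AE x in lborel. 0 \<le> k x - h x"
    if h: "integrable lborel h" "\<And>x. x \<notin> {a<..<b} \<Longrightarrow> h x = 0"
      "\<And>x. x \<in> {a..b} \<Longrightarrow> u x = u a + (LINT t:{..x}|lborel. h t)"
    and k: "integrable lborel k" "\<And>x. x \<notin> {a<..<b} \<Longrightarrow> k x = 0"
      "\<And>x. x \<in> {a..b} \<Longrightarrow> u x = u a + (LINT t:{..x}|lborel. k t)" for h k :: "real \<Rightarrow> real"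
  proof (rule AE_nonneg_if_integral_Ioc_nonneg)
    define d where "d = (\<lambda>x. k x - h x)"
    have d: "integrable lborel d" unfolding d_def using h(1) k(1) by auto
    have si: "set_integrable lborel S d" "set_integrable lborel S h" "set_integrable lborel S k"
      if "S \<in> sets borel" for S
      using that integrable_mult_indicator[of S lborel, OF _ d] integrable_mult_indicator[of S lborel, OF _ h(1)]
        integrable_mult_indicator[of S lborel, OF _ k(1)]
      unfolding set_integrable_def by simp_all
    have zero: "(LINT t:{..x}|lborel. d t) = 0" for x
    proof -
      define y where "y = max a (min b x)"
      have y: "y \<in> {a..b}" using ab by (auto simp: y_def)
      have "(LINT t:{..x}|lborel. d t) = (LINT t:{..y}|lborel. d t)"
        unfolding set_lebesgue_integral_def
      proof (rule Bochner_Integration.integral_cong)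
        fix t
        show "indicator {..x} t *\<^sub>R d t = indicator {..y} t *\<^sub>R d t"
        proof (cases "t \<in> {a<..<b}")
          case True
          then have "t \<le> x \<longleftrightarrow> t \<le> y" by (auto simp: y_def)
          then show ?thesis by (simp add: indicator_def)
        next
          case False
          then show ?thesis using h(2)[of t] k(2)[of t] by (simp add: d_def)
        qed
      qed simp
      also have "\<dots> = (LINT t:{..y}|lborel. k t) - (LINT t:{..y}|lborel. h t)"
        unfolding d_def by (rule set_integral_diff) (intro si, simp)+
      finally show ?thesis using h(3)[OF y] k(3)[OF y] by linarith
    qed
    fix p q :: real assume pq: "p \<le> q"
    have "{..q} = {..p} \<union> {p<..q}" using pq by auto
    then have "(LINT t:{..q}|lborel. d t) = (LINT t:{..p} \<union> {p<..q}|lborel. d t)" by simp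
    also have "\<dots> = (LINT t:{..p}|lborel. d t) + (LINT t:{p<..q}|lborel. d t)"
      by (rule set_integral_Un) (auto intro: si)
    finally have "(LINT t:{p<..q}|lborel. d t) = 0" using zero by simp
    then show "0 \<le> (LINT x:{p<..q}|lborel. k x - h x)" unfolding d_def by simp
  qed (use h(1) k(1) in auto)
  obtain h where h: "integrable lborel h" "\<And>x. x \<notin> {a<..<b} \<Longrightarrow> h x = 0"
    "AE x in lborel. h x = indicator {a<..<b} x * f x"
    "\<And>x. x \<in> {a..b} \<Longrightarrow> u x = u a + (LINT t:{..x}|lborel. h t)"
    by (rule is_primitive_borel_representative[OF f]) (rule that)
  obtain k where k: "integrable lborel k" "\<And>x. x \<notin> {a<..<b} \<Longrightarrow> k x = 0"
    "AE x in lborel. k x = indicator {a<..<b} x * g x"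
    "\<And>x. x \<in> {a..b} \<Longrightarrow> u x = u a + (LINT t:{..x}|lborel. k t)"
    by (rule is_primitive_borel_representative[OF g]) (rule that)
  have "AE x in lborel. 0 \<le> k x - h x" by (rule *) (rule h k | assumption)+
  moreover have "AE x in lborel. 0 \<le> h x - k x" by (rule *) (rule h k | assumption)+
  ultimately show ?thesis using h(3) k(3) by eventually_elim auto
qed

lemma has_bochner_integral_derivative_Ioo:
  fixes \<psi> \<psi>' :: "real \<Rightarrow> real"
  assumes ab: "a \<le> b" and \<psi>: "\<And>x. (\<psi> has_real_derivative \<psi>' x) (at x)"
    and cont: "continuous_on UNIV \<psi>'"
  shows "has_bochner_integral lborel (\<lambda>x. indicator {a<..<b} x * \<psi>' x) (\<psi> b - \<psi> a)"
proof -
  have [measurable]: "\<psi>' \<in> borel_measurable borel" using cont by (rule borel_measurable_continuous_onI)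
  have "has_bochner_integral lborel (\<lambda>x. \<psi>' x * indicator {a..b} x) (\<psi> b - \<psi> a)"
    using cont by (intro has_bochner_integral_FTC_Icc_real ab \<psi>) (auto simp: continuous_on_eq_continuous_at)
  moreover have "AE x in lborel. \<psi>' x * indicator {a..b} x = indicator {a<..<b} x * \<psi>' x"
    using AE_lborel_singleton[of a] AE_lborel_singleton[of b]
    by eventually_elim (auto split: split_indicator)
  ultimately show ?thesis by (subst (asm) has_bochner_integral_cong_AE) auto
qed

text \<open>Fubini's theorem for \<open>f t * \<psi>' x\<close> on the triangle \<open>t \<le> x\<close>. Boundary terms are kept, since the spikes need not
vanish at the end points of the interval.\<close>

lemma is_primitive_by_parts:
  fixes \<psi> \<psi>' :: "real \<Rightarrow> real"
  assumes ab: "a \<le> b" and prim: "is_primitive a b u f"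
    and \<psi>: "\<And>x. (\<psi> has_real_derivative \<psi>' x) (at x)" and cont: "continuous_on UNIV \<psi>'"
  shows "set_integrable lebesgue {a<..<b} (\<lambda>x. f x * \<psi> x)"
    "set_integrable lebesgue {a<..<b} (\<lambda>x. u x * \<psi>' x)"
    "(LINT x:{a<..<b}|lebesgue. u x * \<psi>' x) + (LINT x:{a<..<b}|lebesgue. f x * \<psi> x)
      = u b * \<psi> b - u a * \<psi> a"
proof -
  obtain h where h: "integrable lborel h" and h0: "\<And>x. x \<notin> {a<..<b} \<Longrightarrow> h x = 0"
    and hf: "AE x in lborel. h x = indicator {a<..<b} x * f x"
    and u: "\<And>x. x \<in> {a..b} \<Longrightarrow> u x = u a + (LINT t:{..x}|lborel. h t)"
    by (rule is_primitive_borel_representative[OF prim]) (rule that)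
  have [measurable]: "h \<in> borel_measurable borel" using h by auto
  have [measurable]: "\<psi>' \<in> borel_measurable borel" using cont by (rule borel_measurable_continuous_onI)
  have \<psi>c: "continuous_on UNIV \<psi>"
    using \<psi> by (auto intro!: continuous_at_imp_continuous_on DERIV_isCont)
  then have [measurable]: "\<psi> \<in> borel_measurable borel" by (rule borel_measurable_continuous_onI)
  define P where "P x = (LINT t:{..x}|lborel. h t)" for x
  have Pc: "continuous_on UNIV P"
    unfolding P_def using isCont_integral_atMost[OF h] by (auto intro!: continuous_at_imp_continuous_on)
  define k where "k x = indicator {a<..<b} x * \<psi>' x" for x
  have kI: "has_bochner_integral lborel k (\<psi> b - \<psi> a)"
    unfolding k_def by (rule has_bochner_integral_derivative_Ioo[OF ab \<psi> cont])
  have k: "integrable lborel k" "(\<integral>x. k x \<partial>lborel) = \<psi> b - \<psi> a"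
    using kI by (auto simp: has_bochner_integral_iff)
  have [measurable]: "k \<in> borel_measurable borel" using k by auto
  have "bounded (\<psi> ` {a..b})"
    by (intro compact_imp_bounded compact_continuous_image continuous_on_subset[OF \<psi>c]) auto
  then obtain B where B: "\<forall>x\<in>{a..b}. \<bar>\<psi> x\<bar> \<le> B" by (auto simp: bounded_iff)
  have h\<psi>: "integrable lborel (\<lambda>x. h x * \<psi> x)"
  proof (rule Bochner_Integration.integrable_bound)
    show "integrable lborel (\<lambda>x. B * h x)" using h by auto
    show "AE x in lborel. norm (h x * \<psi> x) \<le> norm (B * h x)"
    proof (rule AE_I2)
      fix x
      show "norm (h x * \<psi> x) \<le> norm (B * h x)"
      proof (cases "x \<in> {a<..<b}")
        case True
        then have "x \<in> {a..b}" by simp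
        then have "\<bar>\<psi> x\<bar> \<le> B" using B by blast
        then have "\<bar>\<psi> x\<bar> \<le> \<bar>B\<bar>" by linarith
        then have "\<bar>h x\<bar> * \<bar>\<psi> x\<bar> \<le> \<bar>h x\<bar> * \<bar>B\<bar>" by (intro mult_left_mono) auto
        then show ?thesis by (simp add: abs_mult mult.commute)
      qed (simp add: h0)
    qed
  qed auto
  have f\<psi>: "set_integrable lebesgue {a<..<b} (\<lambda>x. f x * \<psi> x)"
    "(LINT x:{a<..<b}|lebesgue. f x * \<psi> x) = (LINT x:{a<..<b}|lborel. h x * \<psi> x)"
  proof -
    have "AE x in lborel. indicator {a<..<b} x * (h x * \<psi> x) = indicator {a<..<b} x * (f x * \<psi> x)"
      using hf by eventually_elim (auto split: split_indicator)
    from set_integral_lebesgue_eq_lborel[OF h\<psi> this]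
    show "set_integrable lebesgue {a<..<b} (\<lambda>x. f x * \<psi> x)"
      "(LINT x:{a<..<b}|lebesgue. f x * \<psi> x) = (LINT x:{a<..<b}|lborel. h x * \<psi> x)" by simp_all
  qed
  have int_h\<psi>: "(LINT x:{a<..<b}|lborel. h x * \<psi> x) = (\<integral>x. h x * \<psi> x \<partial>lborel)"
    unfolding set_lebesgue_integral_def using h0
    by (intro Bochner_Integration.integral_cong) (auto split: split_indicator)
  let ?f = "\<lambda>t x. (if t \<le> x then h t * k x else 0)"
  have prod: "integrable (lborel \<Otimes>\<^sub>M lborel) (case_prod ?f)"
  proof (rule Bochner_Integration.integrable_bound)
    show "integrable (lborel \<Otimes>\<^sub>M lborel) (\<lambda>(t, x). h t * k x)"
      by (rule lborel_pair.Fubini_integrable) (use h k in \<open>auto simp: abs_mult\<close>)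
  qed (auto split: if_splits)
  have inner1: "(\<integral>t. ?f t x \<partial>lborel) = P x * k x" for x
  proof -
    have "(\<integral>t. ?f t x \<partial>lborel) = (\<integral>t. (indicator {..x} t * h t) * k x \<partial>lborel)"
      by (intro Bochner_Integration.integral_cong) (auto split: split_indicator)
    then show ?thesis by (simp add: P_def set_lebesgue_integral_def)
  qed
  have inner2: "(\<integral>x. ?f t x \<partial>lborel) = h t * (\<psi> b - \<psi> t)" for t
  proof (cases "t \<in> {a<..<b}")
    case True
    have "has_bochner_integral lborel (\<lambda>x. indicator {t<..<b} x * \<psi>' x) (\<psi> b - \<psi> t)"
      using True by (intro has_bochner_integral_derivative_Ioo \<psi> cont) auto
    then have "(\<integral>x. h t * (indicator {t<..<b} x * \<psi>' x) \<partial>lborel) = h t * (\<psi> b - \<psi> t)"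
      by (simp add: has_bochner_integral_iff)
    moreover have "(\<integral>x. ?f t x \<partial>lborel) = (\<integral>x. h t * (indicator {t<..<b} x * \<psi>' x) \<partial>lborel)"
    proof (rule integral_cong_AE)
      show "AE x in lborel. ?f t x = h t * (indicator {t<..<b} x * \<psi>' x)"
        using AE_lborel_singleton[of t]
        by eventually_elim (use True in \<open>auto simp: k_def split: split_indicator\<close>)
    qed auto
    ultimately show ?thesis by simp
  next
    case False
    then have "h t = 0" by (rule h0)
    then show ?thesis by (simp cong: if_cong)
  qed
  have "(\<integral>x. P x * k x \<partial>lborel) = (\<integral>t. h t * (\<psi> b - \<psi> t) \<partial>lborel)"
    using lborel_pair.Fubini_integral[OF prod] by (simp add: inner1 inner2)
  also have "\<dots> = \<psi> b * (\<integral>t. h t \<partial>lborel) - (\<integral>t. h t * \<psi> t \<partial>lborel)"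
    using h h\<psi> by (simp add: algebra_simps Bochner_Integration.integral_diff)
  also have "(\<integral>t. h t \<partial>lborel) = u b - u a"
  proof -
    have "(\<integral>t. h t \<partial>lborel) = (LINT t:{..b}|lborel. h t)"
      unfolding set_lebesgue_integral_def using h0
      by (intro Bochner_Integration.integral_cong) (auto split: split_indicator)
    then show ?thesis using u[of b] ab by simp
  qed
  finally have Pk: "(\<integral>x. P x * k x \<partial>lborel) = \<psi> b * (u b - u a) - (\<integral>t. h t * \<psi> t \<partial>lborel)" .
  have Pki: "integrable lborel (\<lambda>x. P x * k x)"
    using lborel_pair.integrable_snd[OF prod] by (simp add: inner1)
  have uk: "integrable lborel (\<lambda>x. u a * k x + P x * k x)" using k Pki by auto
  have u\<psi>: "set_integrable lebesgue {a<..<b} (\<lambda>x. u x * \<psi>' x)"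
    "(LINT x:{a<..<b}|lebesgue. u x * \<psi>' x) = (LINT x:{a<..<b}|lborel. u a * k x + P x * k x)"
  proof -
    have "indicator {a<..<b} x * (u a * k x + P x * k x) = indicator {a<..<b} x * (u x * \<psi>' x)" for x
    proof (cases "x \<in> {a<..<b}")
      case True
      then have "u x = u a + P x" unfolding P_def by (intro u) auto
      then show ?thesis using True by (simp add: k_def distrib_right)
    qed simp
    then have "AE x in lborel. indicator {a<..<b} x * (u a * k x + P x * k x) = indicator {a<..<b} x * (u x * \<psi>' x)"
      by simp
    from set_integral_lebesgue_eq_lborel[OF uk this]
    show "set_integrable lebesgue {a<..<b} (\<lambda>x. u x * \<psi>' x)"
      "(LINT x:{a<..<b}|lebesgue. u x * \<psi>' x) = (LINT x:{a<..<b}|lborel. u a * k x + P x * k x)" by simp_all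
  qed
  have "(LINT x:{a<..<b}|lborel. u a * k x + P x * k x) = (\<integral>x. u a * k x + P x * k x \<partial>lborel)"
    unfolding set_lebesgue_integral_def
    by (intro Bochner_Integration.integral_cong) (auto simp: k_def split: split_indicator)
  also have "\<dots> = u a * (\<psi> b - \<psi> a) + (\<psi> b * (u b - u a) - (\<integral>t. h t * \<psi> t \<partial>lborel))"
    using k Pki Pk by simp
  finally show "(LINT x:{a<..<b}|lebesgue. u x * \<psi>' x) + (LINT x:{a<..<b}|lebesgue. f x * \<psi> x)
      = u b * \<psi> b - u a * \<psi> a"
    using u\<psi>(2) f\<psi>(2) int_h\<psi> by (simp add: algebra_simps)
  show "set_integrable lebesgue {a<..<b} (\<lambda>x. f x * \<psi> x)"
    "set_integrable lebesgue {a<..<b} (\<lambda>x. u x * \<psi>' x)" by fact+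
qed

lemma Lp_on_1_iff: "Lp_on 1 {a<..<b} f \<longleftrightarrow> set_integrable lebesgue {a<..<b} f"
proof -
  have *: "(\<lambda>x. \<bar>f x\<bar> powr 1) = (\<lambda>x. \<bar>f x\<bar>)" by auto
  have **: "set_integrable lebesgue {a<..<b} (\<lambda>x. \<bar>f x\<bar>) \<longleftrightarrow> set_integrable lebesgue {a<..<b} f"
    if "set_borel_measurable lebesgue {a<..<b} f"
  proof
    assume "set_integrable lebesgue {a<..<b} (\<lambda>x. \<bar>f x\<bar>)"
    then show "set_integrable lebesgue {a<..<b} f"
      using that unfolding set_integrable_def set_borel_measurable_def
      by (rule Bochner_Integration.integrable_bound) (auto simp: abs_mult)
  qed (rule set_integrable_abs)
  show ?thesis
    unfolding Lp_on_def * using **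
    by (auto simp: set_borel_measurable_def set_integrable_def borel_measurable_integrable)
qed

lemma weak_derivative_if_is_primitive:
  assumes ab: "a \<le> b" and prim: "is_primitive a b u f"
  shows "weak_derivative a b u f"
  unfolding weak_derivative_def Lp_on_1_iff
proof (intro conjI allI impI)
  show "set_integrable lebesgue {a<..<b} f" using prim by (simp add: is_primitive_def)
  fix \<phi> assume \<phi>: "test_function a b \<phi>"
  then have der: "(\<phi> has_real_derivative deriv \<phi> x) (at x)" for x
    by (auto simp: test_function_def DERIV_deriv_iff_real_differentiable)
  have "\<phi> a = 0" "\<phi> b = 0" using \<phi> by (force simp: test_function_def)+
  then show "(LINT x:{a<..<b}|lebesgue. u x * deriv \<phi> x) = - (LINT x:{a<..<b}|lebesgue. f x * \<phi> x)"
    using is_primitive_by_parts(3)[OF ab prim der] \<phi> by (simp add: test_function_def)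
qed

text \<open>Testing with a primitive of \<open>\<eta> * (z - c)\<close>, where \<open>\<eta>\<close> is a cut-off function on \<open>[p, q]\<close> and \<open>c\<close> the mean of \<open>z\<close> with
weight \<open>\<eta>\<close>, yields that \<open>\<eta> * (z - c)\<^sup>2\<close> has integral zero.\<close>

lemma constant_if_weak_derivative_zero:
  fixes z :: "real \<Rightarrow> real"
  assumes ab: "a < b" and z: "continuous_on {a..b} z"
    and test: "\<And>\<phi>. test_function a b \<phi> \<Longrightarrow> (LINT x:{a<..<b}|lebesgue. z x * deriv \<phi> x) = 0"
    and x: "x \<in> {a..b}"
  shows "z x = z a"
proof -
  have const_on: "\<exists>c. \<forall>x\<in>{p<..<q}. z x = c" if pq: "a < p" "p < q" "q < b" for p q
  proof -
    define \<eta> where "\<eta> x = max 0 ((x - p) * (q - x))" for x :: real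
    have \<eta>0: "\<eta> x = 0" if "x \<notin> {p..q}" for x
    proof -
      have "x < p \<or> q < x" using that by auto
      then have "(x - p) * (q - x) \<le> 0"
        using pq by (auto intro: mult_nonpos_nonneg mult_nonneg_nonpos)
      then show ?thesis by (simp add: \<eta>_def)
    qed
    have \<eta>pos: "\<eta> x > 0" if "x \<in> {p<..<q}" for x
      using that by (auto simp: \<eta>_def less_max_iff_disj)
    have \<eta>nn: "\<eta> x \<ge> 0" for x by (auto simp: \<eta>_def)
    have \<eta>c: "continuous_on S \<eta>" for S unfolding \<eta>_def by (intro continuous_intros)
    have zpq: "continuous_on {p..q} z" using pq by (intro continuous_on_subset[OF z]) auto
    have \<eta>z: "continuous_on {p..q} (\<lambda>x. \<eta> x * z x)" by (intro continuous_intros \<eta>c zpq)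
    have I\<eta>: "integral {p..q} \<eta> > 0"
    proof -
      have "integral {p..q} \<eta> \<noteq> 0"
        using integral_eq_0_iff[OF \<eta>c \<open>p < q\<close>] \<eta>nn \<eta>pos[of "(p+q)/2"] pq by (auto dest!: bspec[of _ _ "(p+q)/2"])
      moreover have "integral {p..q} \<eta> \<ge> 0" using \<eta>nn by (intro integral_nonneg integrable_continuous_interval \<eta>c) auto
      ultimately show ?thesis by simp
    qed
    define c where "c = integral {p..q} (\<lambda>x. \<eta> x * z x) / integral {p..q} \<eta>"
    (* The clamp only extends z continuously to the line; it is the identity where \<eta> is not zero. *)
    define k where "k x = \<eta> x * (z (max a (min b x)) - c)" for x
    have clamp: "continuous_on UNIV (\<lambda>x. z (max a (min b x)))"
      using ab by (intro continuous_on_compose2[OF z] continuous_intros) auto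
    have kc: "continuous_on UNIV k" unfolding k_def by (intro continuous_intros \<eta>c clamp)
    have k_pq: "k x = \<eta> x * (z x - c)" if "x \<in> {p..q}" for x
      using that pq by (auto simp: k_def max_def min_def)
    have k_out: "k x = 0" if "x \<notin> {p..q}" for x using \<eta>0[OF that] by (simp add: k_def)
    have k_int: "integral {p..q} k = 0"
    proof -
      have "integral {p..q} k = integral {p..q} (\<lambda>x. \<eta> x * z x - c * \<eta> x)"
        by (rule integral_cong) (simp add: k_pq algebra_simps)
      also have "\<dots> = integral {p..q} (\<lambda>x. \<eta> x * z x) - c * integral {p..q} \<eta>"
        by (subst integral_diff) (auto intro!: integrable_continuous_interval \<eta>z continuous_intros \<eta>c)
      finally show ?thesis using I\<eta> by (simp add: c_def)
    qed
    have "\<exists>F. \<forall>x :: real. -\<infinity> < ereal x \<longrightarrow> ereal x < \<infinity> \<longrightarrow> (F has_vector_derivative k x) (at x)"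
      by (rule einterval_antiderivative) (use kc in \<open>auto simp: continuous_on_eq_continuous_at\<close>)
    then obtain F where F: "(F has_real_derivative k x) (at x)" for x
      by (auto simp: has_real_derivative_iff_has_vector_derivative)
    define \<phi> where "\<phi> x = F x - F p" for x
    have d\<phi>: "(\<phi> has_real_derivative k x) (at x)" for x
      unfolding \<phi>_def by (auto intro!: derivative_eq_intros F)
    have deriv\<phi>: "deriv \<phi> = k" using d\<phi> by (auto intro!: ext DERIV_imp_deriv)
    have \<phi>_diff: "\<phi> y - \<phi> x = integral {x..y} k" if "x \<le> y" for x y
      using that d\<phi> by (intro integral_unique[symmetric] fundamental_theorem_of_calculus)
        (auto simp: has_real_derivative_iff_has_vector_derivative intro: has_vector_derivative_at_within)
    have \<phi>p: "\<phi> p = 0" by (simp add: \<phi>_def)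
    have "\<phi> q = 0" using \<phi>_diff[of p q] pq k_int \<phi>p by simp
    have "\<phi> x = 0" if "x \<notin> {p..q}" for x
    proof (cases "x < p")
      case True
      then have "integral {x..p} k = integral {x..p} (\<lambda>_. 0)"
        by (intro integral_spike[of "{p}"]) (auto simp: k_out)
      then show ?thesis using \<phi>_diff[of x p] True \<phi>p by simp
    next
      case False
      then have "x > q" using that by auto
      then have "integral {q..x} k = integral {q..x} (\<lambda>_. 0)"
        by (intro integral_spike[of "{q}"]) (auto simp: k_out)
      then show ?thesis using \<phi>_diff[of q x] \<open>q < x\<close> \<open>\<phi> q = 0\<close> by simp
    qed
    then have "test_function a b \<phi>"
      unfolding test_function_def deriv\<phi> using kc pq
      by (intro conjI allI exI[of _ p] exI[of _ q]) (auto simp: real_differentiable_def intro: d\<phi>)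
    from test[OF this] have *: "(LINT x:{a<..<b}|lebesgue. z x * k x) = 0" by (simp add: deriv\<phi>)
    have "(LINT x:{a<..<b}|lebesgue. z x * k x) = (LINT x:{p..q}|lebesgue. z x * k x)"
      unfolding set_lebesgue_integral_def using pq k_out
      by (intro Bochner_Integration.integral_cong) (auto split: split_indicator)
    also have "\<dots> = integral {p..q} (\<lambda>x. z x * k x)"
    proof (rule set_lebesgue_integral_eq_integral)
      have "set_integrable lborel {p..q} (\<lambda>x. z x * k x)"
        by (intro borel_integrable_atLeastAtMost' continuous_intros zpq continuous_on_subset[OF kc]) auto
      then show "set_integrable lebesgue {p..q} (\<lambda>x. z x * k x)"
        unfolding set_integrable_def by (subst integrable_completion) auto
    qed
    finally have zk: "integral {p..q} (\<lambda>x. z x * k x) = 0" using * by simp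
    have kpq: "continuous_on {p..q} k" using kc by (rule continuous_on_subset) auto
    have "integral {p..q} (\<lambda>x. \<eta> x * (z x - c)^2) = integral {p..q} (\<lambda>x. z x * k x - c * k x)"
      by (rule integral_cong) (simp add: k_pq algebra_simps power2_eq_square)
    also have "\<dots> = 0"
      using zk k_int by (subst integral_diff) (auto intro!: integrable_continuous_interval continuous_intros zpq kpq)
    finally have "\<forall>x\<in>{p..q}. \<eta> x * (z x - c)^2 = 0"
      by (subst (asm) integral_eq_0_iff) (use pq \<eta>nn in \<open>auto intro!: continuous_intros \<eta>c zpq\<close>)
    then have "\<forall>x\<in>{p<..<q}. z x = c" using \<eta>pos by force
    then show ?thesis by blast
  qed
  define m where "m = (a + b) / 2"
  have m: "a < m" "m < b" using ab by (auto simp: m_def)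
  have open_const: "z x = z m" if "x \<in> {a<..<b}" for x
  proof -
    define p where "p = (a + min x m) / 2"
    define q where "q = (b + max x m) / 2"
    have pq: "a < p" "p < q" "q < b" "x \<in> {p<..<q}" "m \<in> {p<..<q}"
      using that m by (auto simp: p_def q_def)
    then show ?thesis using const_on[of p q] by force
  qed
  have cl: "closure {a<..<b} = {a..b}" using ab by simp
  have "z x = z m" if "x \<in> {a..b}" for x
    using continuous_constant_on_closure[of "{a<..<b}" z "z m" x] z open_const that cl by auto
  then show ?thesis using x ab by auto
qed

lemma is_primitive_if_weak_derivative:
  assumes ab: "a < b" and u: "continuous_on {a..b} u" and f: "weak_derivative a b u f"
  shows "is_primitive a b u f"
proof -
  have fi: "set_integrable lebesgue {a<..<b} f" using f by (simp add: weak_derivative_def Lp_on_1_iff)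
  define V where "V x = u a + (LINT t:{a<..<x}|lebesgue. f t)" for x
  have Va: "V a = u a" by (simp add: V_def set_lebesgue_integral_def)
  have V: "is_primitive a b V f" 
    unfolding is_primitive_def Va
  proof (intro conjI ballI fi)
    fix x show "V x = u a + (LINT t:{a<..<x}|lebesgue. f t)" by (simp only: V_def)
  qed
  have Vc: "continuous_on {a..b} V" by (rule is_primitive_continuous[OF V])
  define z where "z x = u x - V x" for x
  have "z x = z a" if "x \<in> {a..b}" for x
  proof (rule constant_if_weak_derivative_zero[OF ab _ _ that])
    show "continuous_on {a..b} z" unfolding z_def by (intro continuous_intros u Vc)
    fix \<phi> assume \<phi>: "test_function a b \<phi>"
    have si: "set_integrable lebesgue {a<..<b} (\<lambda>x. g x * deriv \<phi> x)" if "continuous_on {a..b} g" for g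
    proof -
      have "set_integrable lborel {a..b} (\<lambda>x. g x * deriv \<phi> x)"
        using \<phi> by (intro borel_integrable_atLeastAtMost' continuous_intros that)
          (auto simp: test_function_def intro: continuous_on_subset)
      then have "set_integrable lborel {a<..<b} (\<lambda>x. g x * deriv \<phi> x)"
        by (rule set_integrable_subset) auto
      then show ?thesis unfolding set_integrable_def by (subst integrable_completion) auto
    qed
    have "(LINT x:{a<..<b}|lebesgue. z x * deriv \<phi> x)
        = (LINT x:{a<..<b}|lebesgue. u x * deriv \<phi> x) - (LINT x:{a<..<b}|lebesgue. V x * deriv \<phi> x)"
      unfolding z_def left_diff_distrib by (rule set_integral_diff) (intro si u Vc)+
    also have "\<dots> = 0"
      using f weak_derivative_if_is_primitive[OF less_imp_le[OF ab] V] \<phi> by (simp add: weak_derivative_def)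
    finally show "(LINT x:{a<..<b}|lebesgue. z x * deriv \<phi> x) = 0" .
  qed
  then have V_eq: "V x = u x" if "x \<in> {a..b}" for x using that Va by (simp add: z_def)
  show ?thesis
    unfolding is_primitive_def
  proof (intro conjI ballI fi)
    fix x assume "x \<in> {a..b}"
    then show "u x = u a + (LINT t:{a<..<x}|lebesgue. f t)" using V_eq[of x] by (simp only: V_def)
  qed
qed

text \<open>This makes the choice of a weak derivative harmless: every primitive has a weak derivative, and any weak derivative
of a continuous function is again a density of it, hence equal almost everywhere to the given one.\<close>

lemma is_primitive_wderiv:
  assumes ab: "a < b" and prim: "is_primitive a b u f"
  shows "is_primitive a b u (wderiv a b u)"
    "AE x in lborel. x \<in> {a<..<b} \<longrightarrow> wderiv a b u x = f x"
proof -
  have "weak_derivative a b u (wderiv a b u)"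
    unfolding wderiv_def
    by (rule someI[of _ f]) (rule weak_derivative_if_is_primitive[OF less_imp_le[OF ab] prim])
  then show *: "is_primitive a b u (wderiv a b u)"
    by (rule is_primitive_if_weak_derivative[OF ab is_primitive_continuous[OF prim]])
  show "AE x in lborel. x \<in> {a<..<b} \<longrightarrow> wderiv a b u x = f x"
    by (rule is_primitive_AE_unique[OF less_imp_le[OF ab] * prim])
qed

text \<open>If \<open>u\<close> has Lipschitz constant \<open>C\<close>, then \<open>u x + C * x\<close> and \<open>C * x - u x\<close> are nondecreasing and their interval measures add up to
\<open>2 * C\<close> times Lebesgue measure. Both are thus absolutely continuous, and the Radon-Nikodym density of the first
one, minus \<open>C\<close>, is the derivative of \<open>u\<close>.\<close>

lemma is_primitive_if_lipschitz:
  assumes ab: "a < b" and lip: "C-lipschitz_on {a..b} u"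
  obtains f where "is_primitive a b u f" "AE x in lborel. x \<in> {a<..<b} \<longrightarrow> \<bar>f x\<bar> \<le> C"
proof -
  have C0: "C \<ge> 0" using lip by (rule lipschitz_on_nonneg)
  (* Clamping the argument extends u to the whole line with the same Lipschitz constant. *)
  define v where "v x = u (max a (min b x))" for x
  have v_lip: "\<bar>v x - v y\<bar> \<le> C * \<bar>x - y\<bar>" for x y
  proof -
    have "dist (u (max a (min b x))) (u (max a (min b y))) \<le> C * dist (max a (min b x)) (max a (min b y))"
      by (rule lipschitz_onD[OF lip]) (use ab in auto)
    also have "\<dots> \<le> C * \<bar>x - y\<bar>"
      using C0 ab by (intro mult_left_mono) (auto simp: dist_real_def max_def min_def)
    finally show ?thesis by (simp add: v_def dist_real_def)
  qed
  have v_cont: "continuous_on UNIV v"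
    by (rule lipschitz_on_continuous_on[of C]) (use v_lip C0 in \<open>auto intro!: lipschitz_onI simp: dist_real_def\<close>)
  define F where "F x = v x + C * x" for x
  define G where "G x = C * x - v x" for x
  have F_mono: "F x \<le> F y" and G_mono: "G x \<le> G y" if "x \<le> y" for x y
  proof -
    have "\<bar>v x - v y\<bar> \<le> C * y - C * x" using v_lip[of x y] that by (simp add: right_diff_distrib)
    then show "F x \<le> F y" "G x \<le> G y" by (auto simp: F_def G_def)
  qed
  have F_cont: "continuous (at_right x) F" and G_cont: "continuous (at_right x) G" for x
  proof -
    have "isCont v x" using v_cont by (simp add: continuous_on_eq_continuous_at)
    then have "isCont F x" "isCont G x" unfolding F_def G_def by (auto intro!: continuous_intros)
    then show "continuous (at_right x) F" "continuous (at_right x) G"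
      by (auto intro: continuous_at_imp_continuous_at_within)
  qed
  have F_meas: "emeasure (interval_measure F) {p<..q} = ennreal (F q - F p)" if "p \<le> q" for p q
    using that F_mono F_cont by (intro emeasure_interval_measure_Ioc)
  have G_meas: "emeasure (interval_measure G) {p<..q} = ennreal (G q - G p)" if "p \<le> q" for p q
    using that G_mono G_cont by (intro emeasure_interval_measure_Ioc)
  have sum: "emeasure (interval_measure F) A + emeasure (interval_measure G) A
      = emeasure (density lborel (\<lambda>_. ennreal (2 * C))) A" if A: "A \<in> sets borel" for A
  proof (rule emeasure_add_eqI_Ioc[OF _ _ _ _ _ A])
    fix p q :: real
    show "emeasure (density lborel (\<lambda>_. ennreal (2 * C))) {p<..q} < \<infinity>"
      by (cases "p \<le> q") (auto simp: emeasure_density_const ennreal_mult_less_top)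
    assume pq: "p \<le> q"
    have "ennreal (F q - F p) + ennreal (G q - G p) = ennreal (2 * C * (q - p))"
      using F_mono[OF pq] G_mono[OF pq] by (subst ennreal_plus[symmetric]) (auto simp: F_def G_def algebra_simps)
    then show "emeasure (interval_measure F) {p<..q} + emeasure (interval_measure G) {p<..q}
      = emeasure (density lborel (\<lambda>_. ennreal (2 * C))) {p<..q}"
      using pq C0 by (simp add: F_meas G_meas emeasure_density_const ennreal_mult)
  qed auto
  have "absolutely_continuous lborel (interval_measure F)"
    unfolding absolutely_continuous_def
  proof
    fix N assume N: "N \<in> null_sets (lborel :: real measure)"
    then have "emeasure (density lborel (\<lambda>_. ennreal (2 * C))) N = 0"
      by (simp add: emeasure_density_const null_sets_def)
    then have "emeasure (interval_measure F) N = 0" using sum[of N] N by (auto simp: null_sets_def)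
    then show "N \<in> null_sets (interval_measure F)" using N by (auto simp: null_sets_def)
  qed
  then obtain d where d[measurable]: "d \<in> borel_measurable lborel"
    and dF: "density lborel d = interval_measure F"
    using sigma_finite_measure.Radon_Nikodym[OF sigma_finite_lborel, of "interval_measure F"] by auto
  have d_int: "(\<integral>\<^sup>+x. indicator {p<..q} x * d x \<partial>lborel) = ennreal (F q - F p)" if "p \<le> q" for p q
    using F_meas[OF that] unfolding dF[symmetric]
    by (subst (asm) emeasure_density) (auto simp: mult.commute)
  define e where "e x = enn2real (indicator {a<..b} x * d x)" for x
  have "AE x in lborel. indicator {a<..b} x * d x \<noteq> \<infinity>"
    by (rule nn_integral_noteq_infinite) (use d_int[of a b] ab in auto)
  then have e_eq: "AE x in lborel. ennreal (e x) = indicator {a<..b} x * d x"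
    by eventually_elim (auto simp: e_def ennreal_enn2real_if)
  have [measurable]: "e \<in> borel_measurable borel" unfolding e_def by measurable
  have e_nn: "e x \<ge> 0" for x by (simp add: e_def)
  have e_int: "has_bochner_integral lborel (\<lambda>x. indicator {p<..q} x * e x) (F q - F p)"
    if "a \<le> p" "p \<le> q" "q \<le> b" for p q
  proof (rule has_bochner_integral_nn_integral)
    have "(\<integral>\<^sup>+x. ennreal (indicator {p<..q} x * e x) \<partial>lborel) = (\<integral>\<^sup>+x. indicator {p<..q} x * d x \<partial>lborel)"
    proof (rule nn_integral_cong_AE)
      show "AE x in lborel. ennreal (indicator {p<..q} x * e x) = indicator {p<..q} x * d x"
        using e_eq by eventually_elim (use that in \<open>auto split: split_indicator split_indicator_asm\<close>)
    qed
    then show "(\<integral>\<^sup>+x. ennreal (indicator {p<..q} x * e x) \<partial>lborel) = ennreal (F q - F p)"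
      using d_int that by simp
  qed (use e_nn F_mono[OF that(2)] in auto)
  have e0: "e x = 0" if "x \<notin> {a<..b}" for x using that by (auto simp: e_def)
  have ei: "integrable lborel e"
  proof -
    have "integrable lborel (\<lambda>x. indicator {a<..b} x * e x)"
      using e_int[of a b] ab by (simp add: has_bochner_integral_iff)
    moreover have "(\<lambda>x. indicator {a<..b} x * e x) = e" using e0 by (auto split: split_indicator)
    ultimately show ?thesis by simp
  qed
  have Cint: "has_bochner_integral lborel (\<lambda>x. indicator {p<..q} x * c) (c * (q - p))" if "p \<le> q" for p q c :: real
    using that by (auto simp: has_bochner_integral_iff)
  have bound: "AE x in lborel. 0 \<le> indicator {a<..b} x * (2 * C) - e x"
  proof (rule AE_nonneg_if_integral_Ioc_nonneg)
    show "integrable lborel (\<lambda>x. indicator {a<..b} x * (2 * C) - e x)"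
      using ei by (intro Bochner_Integration.integrable_diff) (auto simp: ab less_imp_le)
    fix p q :: real assume pq: "p \<le> q"
    define p' where "p' = max a (min b p)"
    define q' where "q' = max a (min b q)"
    have pq': "a \<le> p'" "p' \<le> q'" "q' \<le> b" using ab pq by (auto simp: p'_def q'_def)
    have "(LINT x:{p<..q}|lborel. indicator {a<..b} x * (2 * C) - e x)
        = (\<integral>x. indicator {p'<..q'} x * (2 * C) - indicator {p'<..q'} x * e x \<partial>lborel)"
      unfolding set_lebesgue_integral_def
      by (intro Bochner_Integration.integral_cong) (auto simp: p'_def q'_def e0 split: split_indicator)
    also have "\<dots> = 2 * C * (q' - p') - (F q' - F p')"
      using e_int[OF pq'] Cint[OF pq'(2), of "2*C"]
      by (subst Bochner_Integration.integral_diff) (auto simp: has_bochner_integral_iff)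
    also have "\<dots> = G q' - G p'" by (simp add: F_def G_def algebra_simps)
    also have "\<dots> \<ge> 0" using G_mono[OF pq'(2)] by simp
    finally show "0 \<le> (LINT x:{p<..q}|lborel. indicator {a<..b} x * (2 * C) - e x)" .
  qed
  define f where "f x = e x - C" for x
  define h where "h x = indicator {a<..<b} x * f x" for x
  have h_eq: "h x = indicator {a<..<b} x * e x - indicator {a<..<b} x * C" for x
    by (auto simp: h_def f_def split: split_indicator)
  have hi: "integrable lborel h"
    unfolding h_eq using integrable_mult_indicator[of "{a<..<b}" lborel e] ei ab
    by (intro Bochner_Integration.integrable_diff) auto
  have "is_primitive a b u f"
  proof (subst is_primitive_iff_borel[OF hi])
    show "\<forall>x\<in>{a..b}. u x = u a + (LINT t:{..x}|lborel. h t)"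
    proof
      fix x assume x: "x \<in> {a..b}"
      have "(LINT t:{..x}|lborel. h t) = (\<integral>t. indicator {a<..x} t * e t - indicator {a<..x} t * C \<partial>lborel)"
        unfolding set_lebesgue_integral_def
      proof (rule integral_cong_AE)
        show "AE t in lborel. indicator {..x} t *\<^sub>R h t = indicator {a<..x} t * e t - indicator {a<..x} t * C"
          using AE_lborel_singleton[of b]
          by eventually_elim (use x in \<open>auto simp: h_eq split: split_indicator\<close>)
      qed (use hi in auto)
      also have "\<dots> = (F x - F a) - C * (x - a)"
        using e_int[of a x] Cint[of a x C] x
        by (subst Bochner_Integration.integral_diff) (auto simp: has_bochner_integral_iff)
      also have "\<dots> = u x - u a"
      proof -
        have "max a (min b x) = x" "max a (min b a) = a" using x ab by auto
        then show ?thesis by (simp add: F_def v_def right_diff_distrib)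
      qed
      finally show "u x = u a + (LINT t:{..x}|lborel. h t)" by simp
    qed
  qed (auto simp: h_def)
  moreover have "AE x in lborel. x \<in> {a<..<b} \<longrightarrow> \<bar>f x\<bar> \<le> C"
    using bound
  proof eventually_elim
    case (elim x)
    show ?case
    proof
      assume "x \<in> {a<..<b}"
      then have "e x \<le> 2 * C" using elim by simp
      then show "\<bar>f x\<bar> \<le> C" using e_nn[of x] by (simp add: f_def abs_le_iff)
    qed
  qed
  ultimately show ?thesis using that by blast
qed

lemma set_integrable_lebesgue_continuous:
  fixes h :: "real \<Rightarrow> real"
  assumes h: "continuous_on {p..q} h"
  shows "set_integrable lebesgue {p<..<q} h"
proof -
  have "set_integrable lborel {p..q} h" by (rule borel_integrable_atLeastAtMost'[OF h])
  then have "set_integrable lborel {p<..<q} h" by (rule set_integrable_subset) auto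
  then show ?thesis unfolding set_integrable_def by (subst integrable_completion) auto
qed

lemma abs_powr_2: "\<bar>x::real\<bar> powr 2 = x\<^sup>2"
  by (cases "x = 0") (auto simp: powr_numeral)

lemma sobolev_if_is_primitive:
  assumes ab: "a \<le> b" and prim: "is_primitive a b u f" and r: "r > 0" and f: "Lp_on r {a<..<b} f"
  shows "u \<in> sobolev r a b"
proof -
  have u: "continuous_on {a..b} u" by (rule is_primitive_continuous[OF prim])
  have "set_integrable lebesgue {a<..<b} u" by (rule set_integrable_lebesgue_continuous[OF u])
  moreover have "set_integrable lebesgue {a<..<b} (\<lambda>x. \<bar>u x\<bar> powr r)"
    using r by (intro set_integrable_lebesgue_continuous continuous_on_powr' continuous_intros u) auto
  ultimately have "Lp_on r {a<..<b} u"
    by (auto simp: Lp_on_def set_borel_measurable_def set_integrable_def)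
  then show ?thesis
    unfolding sobolev_def using u f weak_derivative_if_is_primitive[OF ab prim] by blast
qed

lemma is_primitive_combine:
  assumes u: "is_primitive a b u f" and v: "is_primitive a b v g"
  shows "is_primitive a b (\<lambda>x. u x + v x) (\<lambda>x. f x + g x)"
    "is_primitive a b (\<lambda>x. u x - v x) (\<lambda>x. f x - g x)"
proof -
  have fi: "set_integrable lebesgue {a<..<b} f" and gi: "set_integrable lebesgue {a<..<b} g"
    using u v by (auto simp: is_primitive_def)
  have eqs: "(LINT t:{a<..<x}|lebesgue. f t + g t) = (LINT t:{a<..<x}|lebesgue. f t) + (LINT t:{a<..<x}|lebesgue. g t)"
    "(LINT t:{a<..<x}|lebesgue. f t - g t) = (LINT t:{a<..<x}|lebesgue. f t) - (LINT t:{a<..<x}|lebesgue. g t)"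
    if "x \<in> {a..b}" for x
  proof -
    have "set_integrable lebesgue {a<..<x} f" by (rule set_integrable_subset[OF fi]) (use that in auto)
    moreover have "set_integrable lebesgue {a<..<x} g" by (rule set_integrable_subset[OF gi]) (use that in auto)
    ultimately show "(LINT t:{a<..<x}|lebesgue. f t + g t) = (LINT t:{a<..<x}|lebesgue. f t) + (LINT t:{a<..<x}|lebesgue. g t)"
      "(LINT t:{a<..<x}|lebesgue. f t - g t) = (LINT t:{a<..<x}|lebesgue. f t) - (LINT t:{a<..<x}|lebesgue. g t)"
      by (rule set_integral_add(2) set_integral_diff(2))+
  qed
  have ux: "u x = u a + (LINT t:{a<..<x}|lebesgue. f t)" and vx: "v x = v a + (LINT t:{a<..<x}|lebesgue. g t)"
    if "x \<in> {a..b}" for x using u v that unfolding is_primitive_def by blast+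
  show "is_primitive a b (\<lambda>x. u x + v x) (\<lambda>x. f x + g x)"
    unfolding is_primitive_def
  proof (intro conjI ballI set_integral_add(1) fi gi)
    fix x assume x: "x \<in> {a..b}"
    show "u x + v x = u a + v a + (LINT t:{a<..<x}|lebesgue. f t + g t)"
      using ux[OF x] vx[OF x] eqs(1)[OF x] by linarith
  qed
  show "is_primitive a b (\<lambda>x. u x - v x) (\<lambda>x. f x - g x)"
    unfolding is_primitive_def
  proof (intro conjI ballI set_integral_diff(1) fi gi)
    fix x assume x: "x \<in> {a..b}"
    show "u x - v x = u a - v a + (LINT t:{a<..<x}|lebesgue. f t - g t)"
      using ux[OF x] vx[OF x] eqs(2)[OF x] by linarith
  qed
qed

lemma energy_if_is_primitive:
  assumes T: "T > 0" and prim: "is_primitive (-T) T u f"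
  shows "energy L T u = (\<integral>\<^sup>+t\<in>{-T<..<T}. ennreal (L t (u t) (f t)) \<partial>lebesgue)"
  unfolding energy_def
proof (rule nn_integral_cong_AE)
  have "AE x in lebesgue. x \<in> {-T<..<T} \<longrightarrow> wderiv (-T) T u x = f x"
    by (rule AE_completion, rule is_primitive_wderiv(2)[OF _ prim]) (use T in auto)
  then show "AE x in lebesgue. ennreal (L x (u x) (wderiv (-T) T u x)) * indicator {-T<..<T} x
    = ennreal (L x (u x) (f x)) * indicator {-T<..<T} x"
    by eventually_elim (auto split: split_indicator)
qed

lemma is_primitive_if_sobolev_1:
  assumes "a < b" "u \<in> sobolev 1 a b"
  obtains f where "is_primitive a b u f"
  using assms is_primitive_if_weak_derivative[OF assms(1)] by (auto simp: sobolev_def)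

lemma set_nn_integral_eq_set_integral:
  fixes f :: "real \<Rightarrow> real"
  assumes f: "set_integrable M S f" and nn: "\<And>x. x \<in> S \<Longrightarrow> 0 \<le> f x"
  shows "(\<integral>\<^sup>+x\<in>S. ennreal (f x) \<partial>M) = ennreal (LINT x:S|M. f x)"
proof -
  have "(\<integral>\<^sup>+x\<in>S. ennreal (f x) \<partial>M) = (\<integral>\<^sup>+x. ennreal (indicator S x *\<^sub>R f x) \<partial>M)"
    by (intro nn_integral_cong) (auto split: split_indicator)
  also have "\<dots> = ennreal (LINT x:S|M. f x)"
    unfolding set_lebesgue_integral_def
    by (rule nn_integral_eq_integral) (use f nn in \<open>auto simp: set_integrable_def split: split_indicator\<close>)
  finally show ?thesis .
qed

section \<open>The penalty that pays for one spike\<close>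

lemma is_primitive_increment:
  assumes prim: "is_primitive a b u f" and yz: "a \<le> y" "y \<le> z" "z \<le> b"
  shows "u z - u y = (LINT x:{y<..<z}|lebesgue. f x)"
proof -
  have f: "set_integrable lebesgue {a<..<b} f" and
    u: "\<And>x. x \<in> {a..b} \<Longrightarrow> u x = u a + (LINT t:{a<..<x}|lebesgue. f t)"
    using prim unfolding is_primitive_def by blast+
  have uz: "u z = u a + (LINT t:{a<..<z}|lebesgue. f t)" by (rule u) (use yz in auto)
  have uy: "u y = u a + (LINT t:{a<..<y}|lebesgue. f t)" by (rule u) (use yz in auto)
  show ?thesis
  proof (cases "a < y")
    case True
    have si: "set_integrable lebesgue {a<..<y} f" "set_integrable lebesgue {y..<z} f"
      using True yz by (auto intro: set_integrable_subset[OF f])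
    have "{a<..<z} = {a<..<y} \<union> {y..<z}" if "y < z" using True that by auto
    then have eq: "(LINT t:{a<..<z}|lebesgue. f t) = (LINT t:{a<..<y} \<union> {y..<z}|lebesgue. f t)"
      using yz(2) by (cases "y = z") auto
    also have "\<dots> = (LINT t:{a<..<y}|lebesgue. f t) + (LINT t:{y..<z}|lebesgue. f t)"
      by (rule set_integral_Un) (use si in auto)
    also have "(LINT t:{y..<z}|lebesgue. f t) = (LINT t:{y<..<z}|lebesgue. f t)"
      unfolding set_lebesgue_integral_def
    proof (rule integral_cong_AE)
      show "AE t in lebesgue. indicator {y..<z} t *\<^sub>R f t = indicator {y<..<z} t *\<^sub>R f t"
        using AE_completion[OF AE_lborel_singleton[of y]]
        by eventually_elim (auto split: split_indicator)
      have "set_integrable lebesgue {y<..<z} f"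
        using True yz by (auto intro: set_integrable_subset[OF f])
      then show "(\<lambda>t. indicator {y<..<z} t *\<^sub>R f t) \<in> borel_measurable lebesgue"
        unfolding set_integrable_def by (rule borel_measurable_integrable)
      show "(\<lambda>t. indicator {y..<z} t *\<^sub>R f t) \<in> borel_measurable lebesgue"
        using si(2) unfolding set_integrable_def by (rule borel_measurable_integrable)
    qed
    finally show ?thesis using uz uy by linarith
  next
    case False
    then have "y = a" using yz by simp
    then show ?thesis using uz by simp
  qed
qed

text \<open>The interval ends at the first time that \<open>w\<close> reaches \<open>\<beta>\<close> and begins at the last time before that when \<open>w\<close> is at
most \<open>\<alpha>\<close>.\<close>

lemma continuous_crossing:
  fixes w :: "real \<Rightarrow> real"
  assumes w: "continuous_on {p..r} w" and pr: "p \<le> r"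
    and lo: "w p < \<alpha>" and ab: "\<alpha> < \<beta>" and hi: "\<beta> < w r"
  obtains y z where "p \<le> y" "y < z" "z \<le> r" "w y = \<alpha>" "w z = \<beta>"
    "\<And>t. t \<in> {y..z} \<Longrightarrow> w t \<in> {\<alpha>..\<beta>}"
proof -
  define Z where "Z = {p..r} \<inter> w -` {\<beta>..}"
  have "closed Z" unfolding Z_def by (intro continuous_closed_preimage w) auto
  then have "compact ({p..r} \<inter> Z)" by (intro compact_Int_closed) auto
  moreover have "{p..r} \<inter> Z = Z" by (auto simp: Z_def)
  ultimately have "compact Z" by simp
  moreover have "r \<in> Z" using pr hi by (auto simp: Z_def)
  ultimately obtain z where z: "z \<in> Z" "\<And>t. t \<in> Z \<Longrightarrow> z \<le> t"
    using compact_attains_inf[of Z] by auto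
  have zI: "p \<le> z" "z \<le> r" "\<beta> \<le> w z" using z(1) by (auto simp: Z_def)
  have below: "w t < \<beta>" if "p \<le> t" "t < z" for t
    using z(2)[of t] that zI by (force simp: Z_def)
  have wpz: "continuous_on {p..z} w" by (rule continuous_on_subset[OF w]) (use zI in auto)
  obtain t where t: "p \<le> t" "t \<le> z" "w t = \<beta>"
    using IVT'[of w p \<beta> z] lo ab zI wpz by auto
  then have wz: "w z = \<beta>" using below[of t] by (cases "t = z") auto
  define Y where "Y = {p..z} \<inter> w -` {..\<alpha>}"
  have "closed Y" unfolding Y_def by (intro continuous_closed_preimage wpz) auto
  then have "compact ({p..z} \<inter> Y)" by (intro compact_Int_closed) auto
  moreover have "{p..z} \<inter> Y = Y" by (auto simp: Y_def)
  ultimately have "compact Y" by simp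
  moreover have "p \<in> Y" using zI lo by (auto simp: Y_def)
  ultimately obtain y where y: "y \<in> Y" "\<And>t. t \<in> Y \<Longrightarrow> t \<le> y"
    using compact_attains_sup[of Y] by auto
  have yI: "p \<le> y" "y \<le> z" "w y \<le> \<alpha>" using y(1) by (auto simp: Y_def)
  have above: "\<alpha> < w t" if "y < t" "t \<le> z" for t
    using y(2)[of t] that yI by (force simp: Y_def)
  have wyz: "continuous_on {y..z} w" by (rule continuous_on_subset[OF wpz]) (use yI in auto)
  obtain t where t: "y \<le> t" "t \<le> z" "w t = \<alpha>"
    using IVT'[of w y \<alpha> z] yI wz ab wyz by auto
  then have wy: "w y = \<alpha>" using above[of t] by (cases "t = y") auto
  have "y < z" using yI wy wz ab by (cases "y = z") auto
  moreover have "w t \<in> {\<alpha>..\<beta>}" if "t \<in> {y..z}" for t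
    using above[of t] below[of t] that yI wy wz ab by (cases "t = y"; cases "t = z") auto
  ultimately show ?thesis using that yI zI wy wz by blast
qed

text \<open>A tent over \<open>[0, 2 * s]\<close>, reflected to negative arguments: linear with slope \<open>\<kappa>\<close> up to \<open>s\<close>, and zero from
\<open>2 * s\<close> on. The bounded support is what allows infinitely many penalties to be added.\<close>

definition penalty :: "real \<Rightarrow> real \<Rightarrow> real \<Rightarrow> real" where
  "penalty \<kappa> s y = \<kappa> * max 0 (s - \<bar>\<bar>y\<bar> - s\<bar>)"

lemma penalty_nonneg: "\<kappa> \<ge> 0 \<Longrightarrow> 0 \<le> penalty \<kappa> s y"
  by (simp add: penalty_def)

lemma penalty_eq_linear: "\<bar>y\<bar> \<le> s \<Longrightarrow> penalty \<kappa> s y = \<kappa> * \<bar>y\<bar>"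
  by (simp add: penalty_def)

lemma continuous_on_penalty: "continuous_on S (penalty \<kappa> s)"
  unfolding penalty_def[abs_def] by (intro continuous_intros)

text \<open>The threshold \<open>s\<close> separates two ways of paying for the spike. Below it, \<open>2 * f * g\<close> is integrated by
parts into \<open>-2 * v * g'\<close>, which the linear part of the penalty dominates. Above it, Young's inequality bounds the gain
from the spike by \<open>4 * a\<^sup>2 * \<delta> / \<epsilon>\<close> at the price of half of the quadratic term; the other half, together with the penalty, is
at least \<open>3 * a * \<bar>f\<bar>\<close> while \<open>\<bar>v\<bar>\<close> lies in \<open>[s / 2, s]\<close>, and integrated over one crossing of this range it gives
\<open>3 * a * s / 2 = 9 * a\<^sup>2 * \<delta> / (2 * \<epsilon>)\<close>.\<close>

lemma spike_compensated:
  fixes g g' v f :: "real \<Rightarrow> real"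
  assumes pos: "a > 0" "\<delta> > 0" "\<epsilon> > 0" and pq: "p \<le> q"
    and prim: "is_primitive p q v f" and v0: "v p = 0" "v q = 0"
    and f2: "set_integrable lebesgue {p<..<q} (\<lambda>x. (f x)\<^sup>2)"
    and g: "\<And>x. (g has_real_derivative g' x) (at x)" and g'_cont: "continuous_on UNIV g'"
    and g_le: "\<And>x. \<bar>g x\<bar> \<le> a" and g'_le: "\<And>x. \<bar>g' x\<bar> \<le> 2 * a / \<delta>"
    and supp: "\<And>x. \<bar>x - c\<bar> \<ge> \<delta> \<Longrightarrow> g x = 0" "\<And>x. \<bar>x - c\<bar> \<ge> \<delta> \<Longrightarrow> g' x = 0"
  defines "s \<equiv> 3 * a * \<delta> / \<epsilon>"
  shows "0 \<le> 2 * (LINT x:{p<..<q}|lebesgue. f x * g x) + \<epsilon> * (LINT x:{p<..<q}|lebesgue. (f x)\<^sup>2)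
    + (LINT x:{p<..<q}|lebesgue. penalty (4 * a / \<delta>) s (v x))"
proof -
  let ?S = "{p<..<q}"
  let ?\<phi> = "penalty (4 * a / \<delta>) s"
  have s: "s > 0" using pos by (simp add: s_def)
  have v: "continuous_on {p..q} v" by (rule is_primitive_continuous[OF prim])
  have fi: "set_integrable lebesgue ?S f" using prim by (simp add: is_primitive_def)
  have fg: "set_integrable lebesgue ?S (\<lambda>x. f x * g x)"
    and vg: "set_integrable lebesgue ?S (\<lambda>x. v x * g' x)"
    and parts: "(LINT x:?S|lebesgue. v x * g' x) + (LINT x:?S|lebesgue. f x * g x) = 0"
    using is_primitive_by_parts[OF pq prim g g'_cont] v0 by simp_all
  have \<phi>v: "set_integrable lebesgue ?S (\<lambda>x. ?\<phi> (v x))"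
    by (intro set_integrable_lebesgue_continuous continuous_on_compose2[OF continuous_on_penalty v]) auto
  have \<phi>_nn: "?\<phi> y \<ge> 0" for y using pos by (intro penalty_nonneg) auto
  show ?thesis
  proof (cases "\<forall>x\<in>?S. \<bar>x - c\<bar> < \<delta> \<longrightarrow> \<bar>v x\<bar> \<le> s")
    case True
    have "0 \<le> (LINT x:?S|lebesgue. ?\<phi> (v x) - 2 * (v x * g' x))"
      unfolding set_lebesgue_integral_def
    proof (rule Bochner_Integration.integral_nonneg)
      fix x
      have "2 * (v x * g' x) \<le> ?\<phi> (v x)" if x: "x \<in> ?S"
      proof (cases "\<bar>x - c\<bar> < \<delta>")
        case near: True
        have "2 * (v x * g' x) \<le> 2 * (\<bar>v x\<bar> * \<bar>g' x\<bar>)"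
          by (simp add: abs_mult[symmetric])
        also have "\<dots> \<le> 2 * (\<bar>v x\<bar> * (2 * a / \<delta>))"
          using g'_le[of x] by (intro mult_left_mono) auto
        also have "\<dots> = ?\<phi> (v x)"
          using True near x by (simp add: penalty_eq_linear)
        finally show ?thesis .
      qed (use supp(2)[of x] \<phi>_nn in auto)
      then show "0 \<le> indicator ?S x *\<^sub>R (?\<phi> (v x) - 2 * (v x * g' x))"
        by (simp split: split_indicator)
    qed
    also have "\<dots> = (LINT x:?S|lebesgue. ?\<phi> (v x)) - 2 * (LINT x:?S|lebesgue. v x * g' x)"
      using \<phi>v vg by (subst set_integral_diff) (auto intro: set_integrable_mult_right)
    finally have "0 \<le> 2 * (LINT x:?S|lebesgue. f x * g x) + (LINT x:?S|lebesgue. ?\<phi> (v x))"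
      using parts by linarith
    moreover have "0 \<le> \<epsilon> * (LINT x:?S|lebesgue. (f x)\<^sup>2)"
      unfolding set_lebesgue_integral_def using pos
      by (intro mult_nonneg_nonneg Bochner_Integration.integral_nonneg) auto
    ultimately show ?thesis by linarith
  next
    case False
    then obtain r where r: "r \<in> ?S" "s < \<bar>v r\<bar>" by force
    have "continuous_on {p..r} (\<lambda>t. \<bar>v t\<bar>)"
      using r by (intro continuous_intros continuous_on_subset[OF v]) auto
    then obtain y z where yz: "p \<le> y" "y < z" "z \<le> r" and vyz: "\<bar>v y\<bar> = s / 2" "\<bar>v z\<bar> = s"
      and between: "\<And>t. t \<in> {y..z} \<Longrightarrow> \<bar>v t\<bar> \<in> {s/2..s}"
      by (rule continuous_crossing[of p r "\<lambda>t. \<bar>v t\<bar>" "s/2" s]) (use r s v0 that in auto)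
    have sub: "{y<..<z} \<subseteq> ?S" using yz r by auto
    have f_yz: "set_integrable lebesgue {y<..<z} f" by (rule set_integrable_subset[OF fi]) (use sub in auto)
    have "s / 2 \<le> \<bar>v z - v y\<bar>" using vyz by linarith
    also have "v z - v y = (LINT x:{y<..<z}|lebesgue. f x)"
      by (rule is_primitive_increment[OF prim]) (use yz r in auto)
    also have "\<bar>\<dots>\<bar> \<le> (LINT x:{y<..<z}|lebesgue. \<bar>f x\<bar>)"
      using set_integral_norm_bound[OF f_yz] by simp
    finally have cross: "s / 2 \<le> (LINT x:{y<..<z}|lebesgue. \<bar>f x\<bar>)" .
    have g_cont: "continuous_on S g" for S
      using g by (auto intro!: continuous_at_imp_continuous_on DERIV_isCont)
    have g2: "set_integrable lebesgue ?S (\<lambda>x. (g x)\<^sup>2)"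
      by (intro set_integrable_lebesgue_continuous continuous_intros g_cont)
    have g2_le: "(LINT x:?S|lebesgue. (g x)\<^sup>2) \<le> 2 * \<delta> * a\<^sup>2"
    proof -
      have "(LINT x:?S|lebesgue. (g x)\<^sup>2) \<le> (\<integral>x. indicator {c-\<delta>..c+\<delta>} x * a\<^sup>2 \<partial>lebesgue)"
        unfolding set_lebesgue_integral_def
      proof (rule Bochner_Integration.integral_mono)
        show "integrable lebesgue (\<lambda>x. indicator ?S x *\<^sub>R (g x)\<^sup>2)"
          using g2 by (simp add: set_integrable_def)
        show "integrable lebesgue (\<lambda>x. indicator {c-\<delta>..c+\<delta>} x * a\<^sup>2)"
          using pos by (subst integrable_completion) auto
        fix x
        have "(g x)\<^sup>2 \<le> a\<^sup>2" using g_le[of x] by (metis abs_ge_zero abs_le_square_iff abs_of_nonneg order_trans)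
        moreover have "g x = 0" if "x \<notin> {c-\<delta>..c+\<delta>}" using that by (intro supp) auto
        ultimately show "indicator ?S x *\<^sub>R (g x)\<^sup>2 \<le> indicator {c-\<delta>..c+\<delta>} x * a\<^sup>2"
          by (auto split: split_indicator)
      qed
      also have "\<dots> = 2 * \<delta> * a\<^sup>2" using pos by (subst integral_completion) auto
      finally show ?thesis .
    qed
    (* One crossing pays 3 * a * (s / 2), and the spike gains at most the subtracted term. *)
    have low: "3 * a * (s / 2) - 2 / \<epsilon> * (2 * \<delta> * a\<^sup>2)
        \<le> (LINT x:?S|lebesgue. 2 * (f x * g x) + \<epsilon> * (f x)\<^sup>2 + ?\<phi> (v x))"
    proof -
      have "3 * a * (s / 2) \<le> 3 * a * (LINT x:{y<..<z}|lebesgue. \<bar>f x\<bar>)"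
        using cross pos by (intro mult_left_mono) auto
      moreover have "2 / \<epsilon> * (LINT x:?S|lebesgue. (g x)\<^sup>2) \<le> 2 / \<epsilon> * (2 * \<delta> * a\<^sup>2)"
        using g2_le pos by (intro mult_left_mono) auto
      moreover have "3 * a * (LINT x:{y<..<z}|lebesgue. \<bar>f x\<bar>) - 2 / \<epsilon> * (LINT x:?S|lebesgue. (g x)\<^sup>2)
          = (\<integral>x. 3 * a * (indicator {y<..<z} x *\<^sub>R \<bar>f x\<bar>) - 2 / \<epsilon> * (indicator ?S x *\<^sub>R (g x)\<^sup>2) \<partial>lebesgue)"
        unfolding set_lebesgue_integral_def
        using set_integrable_abs[OF f_yz] g2 unfolding set_integrable_def
        by (subst Bochner_Integration.integral_diff) auto
      moreover have "\<dots> \<le> (LINT x:?S|lebesgue. 2 * (f x * g x) + \<epsilon> * (f x)\<^sup>2 + ?\<phi> (v x))"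
        unfolding set_lebesgue_integral_def
      proof (rule Bochner_Integration.integral_mono)
        show "integrable lebesgue (\<lambda>x. 3 * a * (indicator {y<..<z} x *\<^sub>R \<bar>f x\<bar>) - 2 / \<epsilon> * (indicator ?S x *\<^sub>R (g x)\<^sup>2))"
          using set_integrable_abs[OF f_yz] g2 unfolding set_integrable_def by auto
        have "set_integrable lebesgue ?S (\<lambda>x. 2 * (f x * g x) + \<epsilon> * (f x)\<^sup>2 + ?\<phi> (v x))"
          using fg f2 \<phi>v by (intro set_integral_add) (auto intro: set_integrable_mult_right)
        then show "integrable lebesgue (\<lambda>x. indicator ?S x *\<^sub>R (2 * (f x * g x) + \<epsilon> * (f x)\<^sup>2 + ?\<phi> (v x)))"
          by (simp add: set_integrable_def)
        fix x
        show "3 * a * (indicator {y<..<z} x *\<^sub>R \<bar>f x\<bar>) - 2 / \<epsilon> * (indicator ?S x *\<^sub>R (g x)\<^sup>2)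
          \<le> indicator ?S x *\<^sub>R (2 * (f x * g x) + \<epsilon> * (f x)\<^sup>2 + ?\<phi> (v x))"
        proof (cases "x \<in> ?S")
          case x: True
          have young: "- (2 / \<epsilon> * (g x)\<^sup>2) \<le> 2 * (f x * g x) + \<epsilon> / 2 * (f x)\<^sup>2"
          proof -
            have "2 * (f x * g x) + \<epsilon> / 2 * (f x)\<^sup>2 + 2 / \<epsilon> * (g x)\<^sup>2 = \<epsilon> / 2 * (f x + 2 / \<epsilon> * g x)\<^sup>2"
              using pos by (simp add: power2_eq_square field_simps)
            moreover have "\<dots> \<ge> 0" using pos by simp
            ultimately show ?thesis by linarith
          qed
          have "3 * a * (indicator {y<..<z} x *\<^sub>R \<bar>f x\<bar>) \<le> \<epsilon> / 2 * (f x)\<^sup>2 + ?\<phi> (v x)"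
          proof (cases "x \<in> {y<..<z}")
            case True
            then have vx: "s / 2 \<le> \<bar>v x\<bar>" "\<bar>v x\<bar> \<le> s" using between[of x] by auto
            (* The value of the penalty at s / 2, the smallest one on the crossing. *)
            have "6 * a\<^sup>2 / \<epsilon> = 4 * a / \<delta> * (s / 2)" using pos by (simp add: s_def power2_eq_square field_simps)
            also have "\<dots> \<le> 4 * a / \<delta> * \<bar>v x\<bar>" using vx pos by (intro mult_left_mono) auto
            also have "\<dots> = ?\<phi> (v x)" using vx by (simp add: penalty_eq_linear)
            finally have "6 * a\<^sup>2 / \<epsilon> \<le> ?\<phi> (v x)" .
            moreover have "3 * a * \<bar>f x\<bar> \<le> \<epsilon> / 2 * (f x)\<^sup>2 + 6 * a\<^sup>2 / \<epsilon>"
            proof -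
              have "\<epsilon> / 2 * (f x)\<^sup>2 + 6 * a\<^sup>2 / \<epsilon> - 3 * a * \<bar>f x\<bar>
                  = \<epsilon> / 2 * (\<bar>f x\<bar> - 3 * a / \<epsilon>)\<^sup>2 + 3 / 2 * a\<^sup>2 / \<epsilon>"
                using pos by (simp add: power2_eq_square field_simps)
              moreover have "\<dots> \<ge> 0" using pos by simp
              ultimately show ?thesis by linarith
            qed
            ultimately show ?thesis using True by simp
          next
            case False
            then show ?thesis using \<phi>_nn pos by simp
          qed
          then show ?thesis using young x by simp
        next
          case False
          then show ?thesis using sub by (auto split: split_indicator)
        qed
      qed
      ultimately show ?thesis by linarith
    qed
    have "(LINT x:?S|lebesgue. 2 * (f x * g x) + \<epsilon> * (f x)\<^sup>2 + ?\<phi> (v x))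
        = 2 * (LINT x:?S|lebesgue. f x * g x) + \<epsilon> * (LINT x:?S|lebesgue. (f x)\<^sup>2) + (LINT x:?S|lebesgue. ?\<phi> (v x))"
      using fg f2 \<phi>v by (simp add: set_integral_add set_integrable_mult_right)
    moreover have "0 \<le> 3 * a * (s / 2) - 2 / \<epsilon> * (2 * \<delta> * a\<^sup>2)"
      using pos by (simp add: s_def power2_eq_square field_simps)
    ultimately show ?thesis using low by linarith
  qed
qed

section \<open>The family of spikes\<close>

text \<open>The positive part is squared to make the bump continuously differentiable, as the integration by parts against a spike
requires.\<close>

definition bump :: "real \<Rightarrow> real" where "bump x = (max 0 (1 - x\<^sup>2))\<^sup>2"
definition bump' :: "real \<Rightarrow> real" where "bump' x = - 4 * x * max 0 (1 - x\<^sup>2)"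

lemma DERIV_max_0_square: "((\<lambda>y. (max 0 y)\<^sup>2) has_real_derivative 2 * max 0 y) (at (y::real))"
proof -
  consider "y > 0" | "y < 0" | "y = 0" by linarith
  then show ?thesis
  proof cases
    case 1
    have "((\<lambda>y. y\<^sup>2) has_real_derivative 2 * max 0 y) (at y)"
      using 1 by (auto intro!: derivative_eq_intros)
    then show ?thesis
      by (rule has_field_derivative_transform_within_open[where S="{0<..}"]) (use 1 in auto)
  next
    case 2
    have "((\<lambda>_. 0) has_real_derivative 2 * max 0 y) (at y)"
      using 2 by (auto intro!: derivative_eq_intros)
    then show ?thesis
      by (rule has_field_derivative_transform_within_open[where S="{..<0}"]) (use 2 in auto)
  next
    case 3
    have "((\<lambda>h. ((max 0 (0 + h))\<^sup>2 - (max 0 0)\<^sup>2) / h) \<longlongrightarrow> 0) (at (0::real))"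
    proof (rule Lim_null_comparison)
      show "\<forall>\<^sub>F h in at (0::real). norm (((max 0 (0 + h))\<^sup>2 - (max 0 0)\<^sup>2) / h) \<le> \<bar>h\<bar>"
        by (intro always_eventually) (auto simp: max_def power2_eq_square)
      show "((\<lambda>h::real. \<bar>h\<bar>) \<longlongrightarrow> 0) (at 0)" by (intro tendsto_eq_intros) auto
    qed
    then show ?thesis using 3 by (simp add: DERIV_def)
  qed
qed

lemma DERIV_bump: "(bump has_real_derivative bump' x) (at x)"
proof -
  have "((\<lambda>x. 1 - x\<^sup>2) has_real_derivative - 2 * x) (at x)"
    by (auto intro!: derivative_eq_intros)
  from DERIV_chain2[OF DERIV_max_0_square this] show ?thesis
    unfolding bump_def[abs_def] bump'_def by (simp add: mult_ac)
qed

lemma bump_nonneg: "0 \<le> bump x" by (simp add: bump_def)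

lemma bump_le_1: "bump x \<le> 1"
  unfolding bump_def by (intro power_le_one) auto

lemma bump_eq_0: "\<bar>x\<bar> \<ge> 1 \<Longrightarrow> bump x = 0" "\<bar>x\<bar> \<ge> 1 \<Longrightarrow> bump' x = 0"
proof -
  assume "\<bar>x\<bar> \<ge> 1"
  then have "1 \<le> x\<^sup>2" using abs_le_square_iff[of 1 x] by simp
  then show "bump x = 0" "bump' x = 0" by (simp_all add: bump_def bump'_def)
qed

lemma bump_ge_half: assumes "\<bar>x\<bar> \<le> 1/2" shows "1/2 \<le> bump x"
proof -
  have "x\<^sup>2 \<le> (1/2)\<^sup>2" using assms abs_le_square_iff[of x "1/2"] by simp
  then have "x\<^sup>2 \<le> 1/4" by (simp add: power_divide)
  then have "3/4 \<le> max 0 (1 - x\<^sup>2)" unfolding le_max_iff_disj by linarith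
  then have "(3/4)\<^sup>2 \<le> bump x" unfolding bump_def by (rule power_mono) simp
  then show ?thesis by (simp add: power_divide)
qed

lemma abs_bump'_le: "\<bar>bump' x\<bar> \<le> 2"
proof (cases "\<bar>x\<bar> \<ge> 1")
  case False
  define y where "y = \<bar>x\<bar>"
  have y: "0 \<le> y" "y < 1" using False by (auto simp: y_def)
  have "0 \<le> (y - 1/2)\<^sup>2 * (y + 1)" using y by auto
  (* The tangent to y^3 at 1/2 is a convenient lower bound for y^3. *)
  also have "(y - 1/2)\<^sup>2 * (y + 1) = y^3 - 3/4 * y + 1/4"
    by (simp add: power2_eq_square power3_eq_cube field_simps)
  finally have "y - y^3 \<le> 1/2" using y by linarith
  moreover have "y * (1 - y\<^sup>2) = y - y^3" by (simp add: power2_eq_square power3_eq_cube right_diff_distrib)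
  ultimately have "y * (1 - y\<^sup>2) \<le> 1/2" by simp
  moreover have "y\<^sup>2 \<le> 1" using y by (simp add: power_le_one)
  moreover have "\<bar>bump' x\<bar> = 4 * (y * max 0 (1 - y\<^sup>2))"
    by (simp add: bump'_def y_def abs_mult)
  ultimately show ?thesis by simp
qed (simp add: bump_eq_0)

lemma continuous_on_bump': "continuous_on S bump'"
  unfolding bump'_def[abs_def] by (intro continuous_intros)

text \<open>The heights are not summable along any arithmetic progression, which makes the slope unbounded near each centre, while
\<open>height j ^ 2 / budget j\<close> tends to \<open>0\<close>, which makes the penalties small.\<close>

definition height :: "nat \<Rightarrow> real" where "height j = 1 / (real j + 1)"

text \<open>The quadratic exponent gives \<open>width k / width j \<le> (1/2) ^ (j + k + 8)\<close> for \<open>j < k\<close>, enough to absorb the factor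
\<open>144 * (k + 1)\<close> in \<open>spike_penalty_separated\<close>.\<close>

definition width :: "nat \<Rightarrow> real" where "width j = (1/2) ^ (j * (j + 9))"

text \<open>The share of the quadratic term that spike \<open>j\<close> may use. It is of order \<open>j powr (-3/2)\<close>, and the partial sums telescope to
a value below \<open>1\<close>.\<close>

definition budget :: "nat \<Rightarrow> real" where "budget j = 1 / sqrt (real j + 1) - 1 / sqrt (real j + 2)"

text \<open>The spikes with \<open>j + 1 = 2 ^ i * (2 * m + 1)\<close> sit at the \<open>i\<close>-th rational number. Their indices form an arithmetic
progression, so their heights have a divergent sum.\<close>

definition centre :: "nat \<Rightarrow> real" where "centre j = real_of_rat (nat_to_rat_surj (multiplicity 2 (j + 1)))"
definition threshold :: "nat \<Rightarrow> real" where "threshold j = 3 * height j * width j / budget j"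

definition spike :: "nat \<Rightarrow> real \<Rightarrow> real" where
  "spike j t = height j * bump ((t - centre j) / width j)"
definition spike' :: "nat \<Rightarrow> real \<Rightarrow> real" where
  "spike' j t = height j / width j * bump' ((t - centre j) / width j)"
definition spike_penalty :: "nat \<Rightarrow> real \<Rightarrow> real" where
  "spike_penalty j = penalty (4 * height j / width j) (threshold j)"

lemma height_pos: "height j > 0" and height_le_1: "height j \<le> 1"
  by (auto simp: height_def field_simps)

lemma width_pos: "width j > 0" by (simp add: width_def)

lemma budget_pos: "budget j > 0"
  by (simp add: budget_def frac_less2)

lemma sum_budget_le_1: "(\<Sum>j<n. budget j) \<le> 1"
proof -
  have "(\<Sum>j<n. budget j) = 1 - 1 / sqrt (real n + 1)"
    by (induction n) (auto simp: budget_def add_ac)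
  then show ?thesis by simp
qed

lemma inverse_budget_le: "1 / budget j \<le> 6 * (real j + 1) * sqrt (real j + 1)"
proof -
  define x where "x = sqrt (real j + 1)"
  define y where "y = sqrt (real j + 2)"
  have x: "x > 0" "x\<^sup>2 = real j + 1" and y: "y > 0" "y\<^sup>2 = real j + 2"
    by (auto simp: x_def y_def)
  (* Only the order of magnitude matters: y = sqrt (x^2 + 1) is replaced by a multiple of x. *)
  have "y \<le> 2 * x" unfolding x_def y_def by (rule real_le_lsqrt) (auto simp: power_mult_distrib)
  have "(y - x) * (y + x) = 1" using x y by (simp add: power2_eq_square algebra_simps)
  then have yx: "y - x = 1 / (y + x)" using x y by (simp add: field_simps)
  have "budget j = 1 / x - 1 / y" by (simp only: budget_def x_def y_def)
  also have "\<dots> = (y - x) / (x * y)" using x(1) y(1) by (simp add: field_simps)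
  finally have "budget j = (y - x) / (x * y)" .
  then have "1 / budget j = x * (y * (y + x))" using x y by (simp add: yx)
  also have "\<dots> \<le> x * ((2 * x) * (3 * x))"
    using x y \<open>y \<le> 2 * x\<close> by (intro mult_left_mono mult_mono) auto
  also have "\<dots> = 6 * x\<^sup>2 * x" by (simp add: power2_eq_square)
  finally show ?thesis unfolding x(2) by (simp only: x_def)
qed

lemma threshold_pos: "threshold j > 0"
  by (simp add: threshold_def height_pos width_pos budget_pos)

lemma threshold_le: "threshold j \<le> 18 * (real j + 1) * width j"
proof -
  have "threshold j = 3 * width j * (height j * (1 / budget j))" by (simp add: threshold_def)
  also have "\<dots> \<le> 3 * width j * (height j * (6 * (real j + 1) * sqrt (real j + 1)))"
    using inverse_budget_le[of j] height_pos[of j] width_pos[of j] by (intro mult_left_mono) auto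
  also have "\<dots> = 18 * width j * sqrt (real j + 1)"
    by (simp add: height_def field_simps)
  also have "\<dots> \<le> 18 * width j * (real j + 1)"
    using width_pos[of j] by (intro mult_left_mono real_le_lsqrt) (auto simp: power2_eq_square)
  finally show ?thesis by (simp add: mult_ac)
qed

section \<open>The total penalty\<close>

lemma spike_penalty_nonneg: "0 \<le> spike_penalty j y"
  unfolding spike_penalty_def using height_pos[of j] width_pos[of j] by (intro penalty_nonneg) auto

lemma spike_penalty_0: "spike_penalty j 0 = 0"
  using threshold_pos[of j] by (simp add: spike_penalty_def penalty_def)

lemma spike_penalty_le: "spike_penalty j y \<le> 72 / sqrt (real j + 1)"
proof -
  have "spike_penalty j y \<le> 4 * height j / width j * threshold j"
    unfolding spike_penalty_def penalty_def using height_pos[of j] width_pos[of j] threshold_pos[of j]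
    by (intro mult_left_mono) auto
  also have "\<dots> = 12 * (height j)\<^sup>2 * (1 / budget j)"
    using width_pos[of j] by (simp add: threshold_def power2_eq_square)
  also have "\<dots> \<le> 12 * (height j)\<^sup>2 * (6 * (real j + 1) * sqrt (real j + 1))"
    using inverse_budget_le[of j] by (intro mult_left_mono) auto
  also have "\<dots> = 72 * (sqrt (real j + 1) / (real j + 1))"
  proof -
    have "12 * (1 / x)\<^sup>2 * (6 * x * r) = 72 * (r / x)" if "x > 0" for x r :: real
      using that by (simp add: power2_eq_square field_simps)
    from this[of "real j + 1"] show ?thesis by (simp add: height_def)
  qed
  also have "\<dots> = 72 / sqrt (real j + 1)"
    by (simp add: sqrt_divide_self_eq inverse_eq_divide)
  finally show ?thesis .
qed

text \<open>Where the \<open>k\<close>-th penalty is not zero, \<open>y\<close> is at most twice the \<open>k\<close>-th threshold, which is tiny compared with all earlier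
widths; there the linear part of an earlier penalty is negligible.\<close>

lemma spike_penalty_separated:
  assumes jk: "j < k" and nz: "spike_penalty k y \<noteq> 0"
  shows "spike_penalty j y \<le> (1/2) ^ j"
proof -
  have y: "\<bar>y\<bar> \<le> 2 * threshold k"
    using nz by (auto simp: spike_penalty_def penalty_def max_def split: if_splits)
  have "spike_penalty j y \<le> 4 * height j / width j * \<bar>y\<bar>"
    unfolding spike_penalty_def penalty_def using height_pos[of j] width_pos[of j]
    by (intro mult_left_mono) auto
  also have "\<dots> \<le> 4 * 1 / width j * (2 * (18 * (real k + 1) * width k))"
    using height_pos[of j] height_le_1[of j] width_pos[of j] y threshold_le[of k]
    by (intro mult_mono divide_right_mono) auto
  also have "\<dots> = 144 * (real k + 1) * (width k / width j)" by simp
  also have "\<dots> \<le> 2^8 * 2^k * (1/2) ^ (j + k + 8)"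
  proof (intro mult_mono)
    have "real k + 1 \<le> 2 ^ k" by (induction k) auto
    then show "real k + 1 \<le> 2 ^ k" .
    obtain d where d: "k = Suc (j + d)" using jk less_iff_Suc_add by auto
    have "j * (j + 9) + (j + k + 8) \<le> k * (k + 9)" by (simp add: d algebra_simps)
    then have "(1/2::real) ^ (k * (k + 9)) \<le> (1/2) ^ (j * (j + 9) + (j + k + 8))"
      by (intro power_decreasing) auto
    also have "\<dots> = (1/2) ^ (j + k + 8) * width j" by (simp only: width_def power_add mult.commute)
    finally show "width k / width j \<le> (1/2) ^ (j + k + 8)"
      using width_pos[of j] by (simp only: pos_divide_le_eq width_def)
  qed (use width_pos[of j] width_pos[of k] in auto)
  also have "\<dots> = (1/2) ^ j"
    by (simp add: power_add power_divide)
  finally show ?thesis .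
qed

text \<open>At a given \<open>y\<close>, let \<open>n\<close> be the last index with a nonzero penalty. Its term is bounded by the maximum of that penalty, all
earlier terms by a geometric series. The bound is uniform in \<open>y\<close>.\<close>

lemma spike_penalty_tail:
  assumes "N \<le> n"
  shows "(\<Sum>j\<in>{N..<n}. spike_penalty j y) \<le> 72 / sqrt (real N + 1) + (\<Sum>j\<in>{N..<n}. (1/2) ^ j)"
  using assms
proof (induction n rule: dec_induct)
  case (step n)
  have le: "72 / sqrt (real n + 1) \<le> 72 / sqrt (real N + 1)"
    using step.hyps by (intro divide_left_mono) auto
  show ?case
  proof (cases "spike_penalty n y = 0")
    case True
    then have "(\<Sum>j\<in>{N..<Suc n}. spike_penalty j y) = (\<Sum>j\<in>{N..<n}. spike_penalty j y)"
      using step.hyps by simp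
    also have "\<dots> \<le> 72 / sqrt (real N + 1) + (\<Sum>j\<in>{N..<n}. (1/2) ^ j)" by (rule step.IH)
    also have "\<dots> \<le> 72 / sqrt (real N + 1) + (\<Sum>j\<in>{N..<Suc n}. (1/2) ^ j)"
      using step.hyps by simp
    finally show ?thesis .
  next
    case False
    have "(\<Sum>j\<in>{N..<n}. spike_penalty j y) \<le> (\<Sum>j\<in>{N..<n}. (1/2) ^ j)"
      using spike_penalty_separated[OF _ False] by (intro sum_mono) auto
    moreover have "spike_penalty n y \<le> 72 / sqrt (real N + 1)"
      using spike_penalty_le[of n y] le by linarith
    moreover have "(\<Sum>j\<in>{N..<Suc n}. spike_penalty j y) = (\<Sum>j\<in>{N..<n}. spike_penalty j y) + spike_penalty n y"
      "(\<Sum>j\<in>{N..<Suc n}. (1/2::real) ^ j) = (\<Sum>j\<in>{N..<n}. (1/2) ^ j) + (1/2) ^ n"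
      using step.hyps by simp_all
    moreover have "(0::real) \<le> (1/2)^n" by (rule zero_le_power) simp
    ultimately show ?thesis by linarith
  qed
qed simp

definition total_penalty :: "real \<Rightarrow> real" where
  "total_penalty y = (\<Sum>j. spike_penalty j y)"

lemma spike_penalty_tail':
  assumes "N \<le> n"
  shows "(\<Sum>j\<in>{N..<n}. spike_penalty j y) \<le> 72 / sqrt (real N + 1) + 2 * (1/2) ^ N"
proof -
  have "(\<Sum>j\<in>{N..<n}. (1/2::real) ^ j) = 2 * (1/2) ^ N - 2 * (1/2) ^ n"
    using assms by (induction n rule: dec_induct) auto
  then have "(\<Sum>j\<in>{N..<n}. (1/2::real) ^ j) \<le> 2 * (1/2) ^ N" by simp
  then show ?thesis using spike_penalty_tail[OF assms, of y] by linarith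
qed

lemma summable_spike_penalty: "summable (\<lambda>j. spike_penalty j y)"
proof (rule bounded_imp_summable)
  show "0 \<le> spike_penalty j y" for j by (rule spike_penalty_nonneg)
  show "(\<Sum>j\<le>n. spike_penalty j y) \<le> 74" for n
    using spike_penalty_tail'[of 0 "Suc n" y] by (simp add: atLeast0LessThan lessThan_Suc_atMost)
qed

lemma sum_spike_penalty_le: "(\<Sum>j<n. spike_penalty j y) \<le> total_penalty y"
  unfolding total_penalty_def
  by (rule sum_le_suminf) (auto intro: summable_spike_penalty spike_penalty_nonneg)

lemma total_penalty_nonneg: "0 \<le> total_penalty y"
  using sum_spike_penalty_le[where n=0] by simp

lemma total_penalty_0: "total_penalty 0 = 0"
  by (simp add: total_penalty_def spike_penalty_0)

text \<open>The Weierstrass test does not apply, since the maxima of the penalties are not summable; uniform convergence comes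
from the bound on the tails.\<close>

lemma continuous_on_total_penalty: "continuous_on UNIV total_penalty"
proof (rule uniform_limit_theorem[where F=sequentially and f="\<lambda>N y. \<Sum>j<N. spike_penalty j y"])
  show "\<forall>\<^sub>F N in sequentially. continuous_on UNIV (\<lambda>y. \<Sum>j<N. spike_penalty j y)"
    unfolding spike_penalty_def by (intro always_eventually allI continuous_intros continuous_on_penalty)
  show "uniform_limit UNIV (\<lambda>N y. \<Sum>j<N. spike_penalty j y) total_penalty sequentially"
  proof (rule uniform_limitI)
    fix e :: real assume "e > 0"
    have "(\<lambda>N. 72 / sqrt (real N + 1) + 2 * (1/2) ^ N) \<longlonglongrightarrow> 0" by real_asymp
    then have "\<forall>\<^sub>F N in sequentially. 72 / sqrt (real N + 1) + 2 * (1/2) ^ N < e"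
      using \<open>e > 0\<close> by (auto dest: order_tendstoD)
    then show "\<forall>\<^sub>F N in sequentially. \<forall>y\<in>UNIV. dist (\<Sum>j<N. spike_penalty j y) (total_penalty y) < e"
    proof eventually_elim
      case (elim N)
      show ?case
      proof
        fix y
        have "total_penalty y \<le> (\<Sum>j<N. spike_penalty j y) + (72 / sqrt (real N + 1) + 2 * (1/2) ^ N)"
          unfolding total_penalty_def
        proof (rule suminf_le_const[OF summable_spike_penalty])
          fix n
          show "(\<Sum>j<n. spike_penalty j y) \<le> (\<Sum>j<N. spike_penalty j y) + (72 / sqrt (real N + 1) + 2 * (1/2) ^ N)"
          proof (cases "N \<le> n")
            case True
            then have "(\<Sum>j<n. spike_penalty j y) = (\<Sum>j<N. spike_penalty j y) + (\<Sum>j\<in>{N..<n}. spike_penalty j y)"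
              by (metis lessThan_atLeast0 sum.atLeastLessThan_concat zero_le)
            then show ?thesis using spike_penalty_tail'[OF True, of y] by linarith
          next
            case False
            then have "(\<Sum>j<n. spike_penalty j y) \<le> (\<Sum>j<N. spike_penalty j y)"
              by (intro sum_mono2) (auto intro: spike_penalty_nonneg)
            moreover have "0 \<le> 72 / sqrt (real N + 1) + 2 * (1/2::real) ^ N" by simp
            ultimately show ?thesis by linarith
          qed
        qed
        then show "dist (\<Sum>j<N. spike_penalty j y) (total_penalty y) < e"
          using elim sum_spike_penalty_le[where n=N and y=y] by (simp add: dist_real_def)
      qed
    qed
  qed
qed auto

section \<open>The slope of the minimizer\<close>

lemma DERIV_spike: "(spike j has_real_derivative spike' j t) (at t)"
proof -
  have "((\<lambda>t. (t - centre j) / width j) has_real_derivative 1 / width j) (at t)"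
    using width_pos[of j] by (auto intro!: derivative_eq_intros)
  from DERIV_cmult[OF DERIV_chain2[OF DERIV_bump this], of "height j"] show ?thesis
    unfolding spike_def[abs_def] spike'_def by (simp add: mult_ac)
qed

lemma continuous_on_spike': "continuous_on S (spike' j)"
  unfolding spike'_def[abs_def]
  by (intro continuous_intros continuous_on_compose2[OF continuous_on_bump'[of UNIV]])
    (use width_pos[of j] in auto)

lemma spike_nonneg: "0 \<le> spike j t"
  unfolding spike_def using height_pos[of j] bump_nonneg by simp

lemma spike_le_height: "spike j t \<le> height j"
  unfolding spike_def using height_pos[of j] bump_le_1 by (simp add: mult_left_le)

lemma spike_le_1: "spike j t \<le> 1"
  using spike_le_height[of j t] height_le_1[of j] by linarith

lemma abs_spike'_le: "\<bar>spike' j t\<bar> \<le> 2 * height j / width j"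
proof -
  have "\<bar>spike' j t\<bar> = height j / width j * \<bar>bump' ((t - centre j) / width j)\<bar>"
    unfolding spike'_def using height_pos[of j] width_pos[of j] by (simp add: abs_mult)
  also have "\<dots> \<le> height j / width j * 2"
    using height_pos[of j] width_pos[of j] abs_bump'_le by (intro mult_left_mono) auto
  finally show ?thesis by (simp add: mult.commute)
qed

lemma spike_eq_0:
  assumes "\<bar>t - centre j\<bar> \<ge> width j"
  shows "spike j t = 0" "spike' j t = 0"
proof -
  have "\<bar>(t - centre j) / width j\<bar> \<ge> 1" using assms width_pos[of j] by (simp add: field_simps)
  then show "spike j t = 0" "spike' j t = 0" by (simp_all add: spike_def spike'_def bump_eq_0)
qed

lemma spike_ge:
  assumes "\<bar>t - centre j\<bar> \<le> width j / 2"
  shows "height j / 2 \<le> spike j t"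
proof -
  have "\<bar>(t - centre j) / width j\<bar> \<le> 1/2" using assms width_pos[of j] by (simp add: field_simps)
  from mult_left_mono[OF bump_ge_half[OF this], of "height j"] show ?thesis
    using height_pos[of j] by (simp add: spike_def)
qed

lemma spike_borel_measurable [measurable]: "spike j \<in> borel_measurable borel"
  using DERIV_spike[of j]
  by (intro borel_measurable_continuous_onI continuous_at_imp_continuous_on) (auto intro: DERIV_isCont)

lemma spike_integral:
  shows "integrable lborel (spike j)" "(\<integral>t. spike j t \<partial>lborel) \<le> 2 * width j"
proof -
  let ?I = "{centre j - width j .. centre j + width j}"
  have le: "spike j t \<le> indicator ?I t" for t
    using spike_eq_0[where t=t and j=j] spike_le_1[of j t] by (auto split: split_indicator)
  have int: "integrable lborel (indicator ?I :: real \<Rightarrow> real)"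
    using width_pos[of j] by (intro integrable_real_indicator) auto
  show *: "integrable lborel (spike j)"
  proof (rule Bochner_Integration.integrable_bound[OF int])
    show "AE t in lborel. norm (spike j t) \<le> norm (indicator ?I t :: real)"
      using le spike_nonneg by (intro AE_I2) auto
  qed simp
  have "(\<integral>t. spike j t \<partial>lborel) \<le> (\<integral>t. indicator ?I t \<partial>lborel)"
    by (intro Bochner_Integration.integral_mono * int le)
  then show "(\<integral>t. spike j t \<partial>lborel) \<le> 2 * width j" using width_pos[of j] by simp
qed

lemma spike_j_compensated:
  assumes "p \<le> q" "is_primitive p q v f" "v p = 0" "v q = 0"
    "set_integrable lebesgue {p<..<q} (\<lambda>x. (f x)\<^sup>2)"
  shows "0 \<le> 2 * (LINT x:{p<..<q}|lebesgue. f x * spike j x)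
    + budget j * (LINT x:{p<..<q}|lebesgue. (f x)\<^sup>2)
    + (LINT x:{p<..<q}|lebesgue. spike_penalty j (v x))"
  unfolding spike_penalty_def threshold_def
proof (rule spike_compensated[where g'="spike' j" and c="centre j"])
  show "\<bar>spike j x\<bar> \<le> height j" for x using spike_nonneg[of j x] spike_le_height[of j x] by simp
qed (use assms height_pos width_pos budget_pos DERIV_spike continuous_on_spike' abs_spike'_le spike_eq_0 in auto)

text \<open>If \<open>0 \<le> k j \<le> 1\<close>, then the square of a partial sum grows from \<open>n\<close> to \<open>n + 1\<close> by at most \<open>(2 * n + 1) * k n\<close>, so the
integrable function \<open>\<Sum>j. (2 * j + 1) * k j\<close> dominates the square of the sum.\<close>

lemma superposition_square_integrable:
  fixes k :: "nat \<Rightarrow> real \<Rightarrow> real"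
  assumes int: "\<And>j. integrable lborel (k j)" and nn: "\<And>j t. 0 \<le> k j t" and le: "\<And>j t. k j t \<le> 1"
    and sum: "summable (\<lambda>j. (2 * real j + 1) * (\<integral>t. k j t \<partial>lborel))"
  shows "AE t in lborel. summable (\<lambda>j. k j t)"
    "integrable lborel (\<lambda>t. \<Sum>j. k j t)" "integrable lborel (\<lambda>t. (\<Sum>j. k j t)\<^sup>2)"
proof -
  define h where "h j t = (2 * real j + 1) * k j t" for j t
  have h: "integrable lborel (h j)" for j unfolding h_def using int by simp
  have [measurable]: "k j \<in> borel_measurable borel" "h j \<in> borel_measurable borel" for j
    using int[of j] h[of j] by auto
  have h_nn: "0 \<le> h j t" for j t using nn by (simp add: h_def)
  have h_sum: "summable (\<lambda>j. \<integral>t. h j t \<partial>lborel)" using sum by (simp add: h_def)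
  have "(\<integral>\<^sup>+t. (\<Sum>j. ennreal (h j t)) \<partial>lborel) = (\<Sum>j. \<integral>\<^sup>+t. ennreal (h j t) \<partial>lborel)"
    by (rule nn_integral_suminf) simp
  also have "\<dots> = (\<Sum>j. ennreal (\<integral>t. h j t \<partial>lborel))"
    using h h_nn by (intro arg_cong[where f=suminf] ext nn_integral_eq_integral) auto
  also have "\<dots> \<noteq> \<infinity>"
    unfolding infinity_ennreal_def
    by (rule ennreal_suminf_neq_top[OF h_sum]) (intro Bochner_Integration.integral_nonneg h_nn)
  finally have "AE t in lborel. (\<Sum>j. ennreal (h j t)) \<noteq> \<infinity>"
    by (intro nn_integral_noteq_infinite) auto
  then have h_ae: "AE t in lborel. summable (\<lambda>j. h j t)"
    by eventually_elim (auto intro!: summable_suminf_not_top h_nn)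
  have k_le_h: "k j t \<le> h j t" for j t
    using mult_right_mono[OF _ nn[of j t], of 1 "2 * real j + 1"] by (simp add: h_def)
  have k_sum: "summable (\<lambda>j. k j t)" if "summable (\<lambda>j. h j t)" for t
    by (rule summable_comparison_test'[OF that, of 0]) (use nn k_le_h in auto)
  show k_ae: "AE t in lborel. summable (\<lambda>j. k j t)"
    using h_ae by eventually_elim (rule k_sum)
  have partial: "(\<Sum>j<n. k j t)\<^sup>2 \<le> (\<Sum>j<n. h j t)" for n t
  proof (induction n)
    case (Suc n)
    have "(\<Sum>j<n. k j t) \<le> (\<Sum>j<n. 1)" by (intro sum_mono le)
    then have "(\<Sum>j<n. k j t) \<le> real n" by simp
    then have "2 * (\<Sum>j<n. k j t) * k n t \<le> 2 * real n * k n t"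
      using nn by (intro mult_right_mono) auto
    moreover have "k n t * k n t \<le> 1 * k n t" using nn le by (intro mult_right_mono) auto
    ultimately show ?case using Suc.IH by (simp add: h_def power2_eq_square algebra_simps)
  qed simp
  have sq_le: "(\<Sum>j. k j t)\<^sup>2 \<le> (\<Sum>j. h j t)" if s: "summable (\<lambda>j. h j t)" for t
  proof (rule LIMSEQ_le_const2)
    show "(\<lambda>n. (\<Sum>j<n. k j t)\<^sup>2) \<longlonglongrightarrow> (\<Sum>j. k j t)\<^sup>2"
      by (intro tendsto_power summable_LIMSEQ k_sum s)
    have "(\<Sum>j<n. k j t)\<^sup>2 \<le> (\<Sum>j. h j t)" for n
      using partial[of t n] sum_le_suminf[OF s, of "{..<n}"] h_nn by force
    then show "\<exists>N. \<forall>n\<ge>N. (\<Sum>j<n. k j t)\<^sup>2 \<le> (\<Sum>j. h j t)" by blast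
  qed
  have H: "integrable lborel (\<lambda>t. \<Sum>j. h j t)"
    by (rule integrable_suminf) (use h h_ae h_nn h_sum in auto)
  show "integrable lborel (\<lambda>t. (\<Sum>j. k j t)\<^sup>2)"
  proof (rule Bochner_Integration.integrable_bound[OF H])
    show "AE t in lborel. norm ((\<Sum>j. k j t)\<^sup>2) \<le> norm (\<Sum>j. h j t)"
      using h_ae by eventually_elim (use sq_le in force)
  qed measurable
  show "integrable lborel (\<lambda>t. \<Sum>j. k j t)"
  proof (rule Bochner_Integration.integrable_bound[OF H])
    show "AE t in lborel. norm (\<Sum>j. k j t) \<le> norm (\<Sum>j. h j t)"
      using h_ae
    proof eventually_elim
      case (elim t)
      have "0 \<le> (\<Sum>j. k j t)" by (rule suminf_nonneg[OF k_sum[OF elim] nn])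
      moreover have "(\<Sum>j. k j t) \<le> (\<Sum>j. h j t)" by (rule suminf_le[OF k_le_h k_sum[OF elim] elim])
      ultimately show ?case by simp
    qed
  qed measurable
qed

definition slope :: "real \<Rightarrow> real" where "slope t = (\<Sum>j. spike j t)"

lemma slope_integrable:
  shows AE_summable_spike: "AE t in lborel. summable (\<lambda>j. spike j t)"
    and integrable_slope: "integrable lborel slope"
    and integrable_slope_square: "integrable lborel (\<lambda>t. (slope t)\<^sup>2)"
proof -
  have "summable (\<lambda>j. (2 * real j + 1) * (\<integral>t. spike j t \<partial>lborel))"
  proof (rule summable_comparison_test'[where N=0])
    show "summable (\<lambda>j. 4 * (1/2::real) ^ j)" by (intro summable_mult summable_geometric) auto
    fix j :: nat
    have "(2 * real j + 1) * (\<integral>t. spike j t \<partial>lborel) \<le> (2 * 2 ^ j) * (2 * (1/2) ^ (2 * j))"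
    proof (intro mult_mono)
      have "real j + 1 \<le> 2 ^ j" by (induction j) auto
      then show "2 * real j + 1 \<le> 2 * 2 ^ j" by linarith
      have "2 * j \<le> j * (j + 9)" by (simp add: algebra_simps)
      then have "width j \<le> (1/2) ^ (2 * j)" unfolding width_def by (intro power_decreasing) auto
      then show "(\<integral>t. spike j t \<partial>lborel) \<le> 2 * (1/2) ^ (2 * j)"
        using spike_integral(2)[of j] by linarith
    qed (auto intro: Bochner_Integration.integral_nonneg spike_nonneg)
    also have "\<dots> = 4 * (1/2) ^ j" by (simp add: power_mult power_divide power2_eq_square power_mult_distrib field_simps)
    finally show "norm ((2 * real j + 1) * (\<integral>t. spike j t \<partial>lborel)) \<le> 4 * (1/2) ^ j"
      by (simp add: Bochner_Integration.integral_nonneg spike_nonneg)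
  qed
  from superposition_square_integrable[OF spike_integral(1) spike_nonneg spike_le_1 this]
  show "AE t in lborel. summable (\<lambda>j. spike j t)" "integrable lborel slope"
    "integrable lborel (\<lambda>t. (slope t)\<^sup>2)" by (simp_all add: slope_def[abs_def])
qed

lemma slope_measurable [measurable]: "slope \<in> borel_measurable borel"
  using integrable_slope by auto

lemma set_integrable_lebesgue_if_lborel:
  fixes h :: "real \<Rightarrow> real"
  assumes "integrable lborel h" and S: "S \<in> sets borel"
  shows "set_integrable lebesgue S h"
  using integrable_mult_indicator[of S lborel h] assms
  unfolding set_integrable_def by (subst integrable_completion) auto

text \<open>Adding the estimates for the single spikes: the shares of the quadratic term add up to at most one,
the penalties to at most the total penalty. Dominated convergence with the bound \<open>f\<^sup>2 + slope\<^sup>2\<close> passes from finitely many spikes to the slope.\<close>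

lemma slope_compensated:
  assumes pq: "p \<le> q" and prim: "is_primitive p q v f" and v0: "v p = 0" "v q = 0"
    and f2: "set_integrable lebesgue {p<..<q} (\<lambda>x. (f x)\<^sup>2)"
  shows "set_integrable lebesgue {p<..<q} (\<lambda>x. f x * slope x)"
    "0 \<le> 2 * (LINT x:{p<..<q}|lebesgue. f x * slope x) + (LINT x:{p<..<q}|lebesgue. (f x)\<^sup>2)
      + (LINT x:{p<..<q}|lebesgue. total_penalty (v x))"
proof -
  let ?S = "{p<..<q}"
  have v: "continuous_on {p..q} v" by (rule is_primitive_continuous[OF prim])
  have fi: "set_integrable lebesgue ?S f" using prim by (simp add: is_primitive_def)
  have f_meas: "(\<lambda>x. indicator ?S x * f x) \<in> borel_measurable lebesgue"
    using fi by (auto simp: set_integrable_def)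
  have slope_meas: "slope \<in> borel_measurable lebesgue" by (intro measurable_completion) simp
  have s2: "set_integrable lebesgue ?S (\<lambda>x. (slope x)\<^sup>2)"
    by (rule set_integrable_lebesgue_if_lborel[OF integrable_slope_square]) simp
  have dom: "integrable lebesgue (\<lambda>x. indicator ?S x * ((f x)\<^sup>2 + (slope x)\<^sup>2))"
    using set_integral_add(1)[OF f2 s2] by (simp add: set_integrable_def)
  have amgm: "\<bar>a * b\<bar> \<le> a\<^sup>2 + b\<^sup>2" for a b :: real
  proof -
    have "2 * (\<bar>a\<bar> * \<bar>b\<bar>) \<le> \<bar>a\<bar>\<^sup>2 + \<bar>b\<bar>\<^sup>2" using sum_squares_bound[of "\<bar>a\<bar>" "\<bar>b\<bar>"] by (simp add: mult.assoc)
    moreover have "0 \<le> \<bar>a\<bar> * \<bar>b\<bar>" by simp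
    moreover have "\<bar>a * b\<bar> = \<bar>a\<bar> * \<bar>b\<bar>" by (rule abs_mult)
    moreover have "\<bar>a\<bar>\<^sup>2 = a\<^sup>2" "\<bar>b\<bar>\<^sup>2 = b\<^sup>2" by simp_all
    ultimately show ?thesis by linarith
  qed
  have fs_meas: "(\<lambda>x. indicator ?S x * (f x * slope x)) \<in> borel_measurable lebesgue"
    using borel_measurable_times[OF f_meas slope_meas] by (simp add: mult.assoc)
  have "integrable lebesgue (\<lambda>x. indicator ?S x * (f x * slope x))"
  proof (rule Bochner_Integration.integrable_bound[OF dom fs_meas])
    show "AE x in lebesgue. norm (indicator ?S x * (f x * slope x)) \<le> norm (indicator ?S x * ((f x)\<^sup>2 + (slope x)\<^sup>2))"
      using amgm by (intro AE_I2) (auto simp: abs_mult[symmetric] split: split_indicator)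
  qed
  then show fs: "set_integrable lebesgue ?S (\<lambda>x. f x * slope x)" by (simp add: set_integrable_def)
  have fj: "set_integrable lebesgue ?S (\<lambda>x. f x * spike j x)" for j
    by (rule is_primitive_by_parts(1)[OF pq prim DERIV_spike continuous_on_spike'])
  have \<phi>j: "set_integrable lebesgue ?S (\<lambda>x. spike_penalty j (v x))" for j
    unfolding spike_penalty_def
    by (intro set_integrable_lebesgue_continuous continuous_on_compose2[OF continuous_on_penalty v]) auto
  have \<Phi>: "set_integrable lebesgue ?S (\<lambda>x. total_penalty (v x))"
    by (intro set_integrable_lebesgue_continuous continuous_on_compose2[OF continuous_on_total_penalty v]) auto
  define E where "E = (LINT x:?S|lebesgue. (f x)\<^sup>2)"
  have E0: "E \<ge> 0" unfolding E_def set_lebesgue_integral_def by (intro Bochner_Integration.integral_nonneg) auto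
  define P where "P = (LINT x:?S|lebesgue. total_penalty (v x))"
  have finite_sum: "0 \<le> 2 * (LINT x:?S|lebesgue. f x * (\<Sum>j<n. spike j x)) + E + P" for n
  proof -
    have "0 \<le> (\<Sum>j<n. 2 * (LINT x:?S|lebesgue. f x * spike j x) + budget j * E
        + (LINT x:?S|lebesgue. spike_penalty j (v x)))"
      unfolding E_def by (intro sum_nonneg spike_j_compensated[OF pq prim v0 f2])
    also have "\<dots> = 2 * (\<Sum>j<n. LINT x:?S|lebesgue. f x * spike j x) + (\<Sum>j<n. budget j) * E
        + (\<Sum>j<n. LINT x:?S|lebesgue. spike_penalty j (v x))"
      by (simp add: sum.distrib sum_distrib_left sum_distrib_right)
    also have "(\<Sum>j<n. LINT x:?S|lebesgue. f x * spike j x) = (LINT x:?S|lebesgue. f x * (\<Sum>j<n. spike j x))"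
      using fj unfolding set_lebesgue_integral_def set_integrable_def
      by (subst Bochner_Integration.integral_sum[symmetric]) (auto simp: sum_distrib_left)
    also have "(\<Sum>j<n. LINT x:?S|lebesgue. spike_penalty j (v x)) = (LINT x:?S|lebesgue. (\<Sum>j<n. spike_penalty j (v x)))"
      using \<phi>j unfolding set_lebesgue_integral_def set_integrable_def
      by (subst Bochner_Integration.integral_sum[symmetric]) (auto simp: sum_distrib_left)
    also have "\<dots> \<le> P"
      unfolding P_def set_lebesgue_integral_def
    proof (rule Bochner_Integration.integral_mono)
      show "integrable lebesgue (\<lambda>x. indicator ?S x *\<^sub>R (\<Sum>j<n. spike_penalty j (v x)))"
        unfolding scaleR_sum_right using \<phi>j unfolding set_integrable_def
        by (intro Bochner_Integration.integrable_sum)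
      show "integrable lebesgue (\<lambda>x. indicator ?S x *\<^sub>R total_penalty (v x))"
        using \<Phi> by (simp add: set_integrable_def)
    qed (auto intro: mult_left_mono sum_spike_penalty_le)
    also have "(\<Sum>j<n. budget j) * E \<le> 1 * E"
      using sum_budget_le_1 E0 by (intro mult_right_mono) auto
    finally show ?thesis by simp
  qed
  have "(\<lambda>n. LINT x:?S|lebesgue. f x * (\<Sum>j<n. spike j x)) \<longlonglongrightarrow> (LINT x:?S|lebesgue. f x * slope x)"
    unfolding set_lebesgue_integral_def real_scaleR_def
  proof (rule integral_dominated_convergence[OF fs_meas _ dom])
    show "(\<lambda>x. indicator ?S x * (f x * (\<Sum>j<n. spike j x))) \<in> borel_measurable lebesgue" for n
    proof -
      have "(\<lambda>x. \<Sum>j<n. spike j x) \<in> borel_measurable lebesgue" by (intro measurable_completion) simp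
      from borel_measurable_times[OF f_meas this] show ?thesis by (simp add: mult.assoc)
    qed
    show "AE x in lebesgue. (\<lambda>n. indicator ?S x * (f x * (\<Sum>j<n. spike j x))) \<longlonglongrightarrow> indicator ?S x * (f x * slope x)"
      using AE_completion[OF AE_summable_spike]
      by eventually_elim (auto simp: slope_def intro!: tendsto_mult summable_LIMSEQ)
    show "AE x in lebesgue. norm (indicator ?S x * (f x * (\<Sum>j<n. spike j x))) \<le> indicator ?S x * ((f x)\<^sup>2 + (slope x)\<^sup>2)" for n
      using AE_completion[OF AE_summable_spike]
    proof eventually_elim
      case (elim x)
      have "0 \<le> (\<Sum>j<n. spike j x)" by (intro sum_nonneg spike_nonneg)
      moreover have "(\<Sum>j<n. spike j x) \<le> slope x"
        unfolding slope_def by (rule sum_le_suminf[OF elim]) (auto intro: spike_nonneg)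
      ultimately have "\<bar>f x * (\<Sum>j<n. spike j x)\<bar> \<le> \<bar>f x * slope x\<bar>"
        unfolding abs_mult by (intro mult_left_mono) auto
      also have "\<dots> \<le> (f x)\<^sup>2 + (slope x)\<^sup>2" by (rule amgm)
      finally show ?case by (simp split: split_indicator)
    qed
  qed
  then have "(\<lambda>n. 2 * (LINT x:?S|lebesgue. f x * (\<Sum>j<n. spike j x)) + E + P)
      \<longlonglongrightarrow> 2 * (LINT x:?S|lebesgue. f x * slope x) + E + P"
    by (intro tendsto_intros)
  then show "0 \<le> 2 * (LINT x:?S|lebesgue. f x * slope x) + (LINT x:?S|lebesgue. (f x)\<^sup>2)
      + (LINT x:?S|lebesgue. total_penalty (v x))"
    unfolding E_def[symmetric] P_def[symmetric]
    by (rule LIMSEQ_le_const) (use finite_sum in blast)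
qed

section \<open>Blow-up on every interval\<close>

lemma centre_two_power:
  assumes "j + 1 = 2 ^ i * (2 * m + 1)"
  shows "centre j = real_of_rat (nat_to_rat_surj i)"
proof -
  have "multiplicity 2 (2 ^ i * (2 * m + 1)) = i"
    by (rule multiplicity_decomposeI[where x'="2*m+1", OF refl]) auto
  then show ?thesis unfolding centre_def assms by simp
qed

lemma width_antimono: "j \<le> k \<Longrightarrow> width k \<le> width j"
  unfolding width_def by (intro power_decreasing mult_mono) auto

text \<open>Within half of the width of the \<open>M\<close>-th spike at the \<open>i\<close>-th rational, all earlier spikes at this rational have at least
half of their height, and these heights are bounded below by a harmonic sum.\<close>

lemma slope_ge_near_centre:
  assumes sum: "summable (\<lambda>j. spike j t)"
    and t: "\<bar>t - real_of_rat (nat_to_rat_surj i)\<bar> \<le> width (2 ^ i * (2 * M + 1) - 1) / 2"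
  shows "(1/2) ^ (i + 2) * ln (real M + 1) \<le> slope t"
proof -
  define e where "e m = 2 ^ i * (2 * m + 1) - (1::nat)" for m
  have e: "e m + 1 = 2 ^ i * (2 * m + 1)" for m by (simp add: e_def)
  (* The spikes e m are pairwise distinct, so the slope dominates the sum of all of them. *)
  have inj: "inj_on e {..<M}"
    by (rule inj_onI) (metis e add_right_cancel mult_left_cancel nat_1_add_1 power_not_zero zero_neq_numeral nat_mult_eq_cancel1 zero_less_numeral)
  have spike_lower: "(1/2) ^ (i + 2) * (1 / real (Suc m)) \<le> spike (e m) t" if "m < M" for m
  proof -
    have "e m \<le> e M" using that by (simp add: e_def diff_le_mono)
    then have "width (e M) \<le> width (e m)" by (rule width_antimono)
    then have "\<bar>t - centre (e m)\<bar> \<le> width (e m) / 2"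
      using t unfolding centre_two_power[OF e] e_def[symmetric] by linarith
    then have "height (e m) / 2 \<le> spike (e m) t" by (rule spike_ge)
    moreover have "real (e m) + 1 = 2 ^ i * (2 * real m + 1)"
      using arg_cong[OF e[of m], of real]
      by (simp only: of_nat_mult of_nat_add of_nat_power of_nat_numeral of_nat_1)
    then have "height (e m) / 2 = 1 / (2 ^ (i + 1) * (2 * real m + 1))" by (simp add: height_def)
    moreover have "1 / (2 ^ (i + 1) * (2 * real m + 2)) \<le> 1 / (2 ^ (i + 1) * (2 * real m + 1))"
      by (intro divide_left_mono mult_left_mono) auto
    moreover have "1 / (2 ^ (i + 1) * (2 * real m + 2)) = (1/2) ^ (i + 2) * (1 / real (Suc m))"
      by (simp add: power_divide field_simps)
    ultimately show ?thesis by linarith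
  qed
  have "(1/2) ^ (i + 2) * ln (real M + 1) \<le> (1/2) ^ (i + 2) * (harm M :: real)"
    using ln_le_harm by (intro mult_left_mono) auto
  also have "harm M = (\<Sum>m<M. 1 / real (Suc m))"
    unfolding harm_def by (rule sum.reindex_bij_witness[of _ Suc "\<lambda>k. k - 1"]) (auto simp: field_simps)
  also have "(1/2) ^ (i + 2) * \<dots> \<le> (\<Sum>m<M. spike (e m) t)"
    unfolding sum_distrib_left by (intro sum_mono spike_lower) auto
  also have "\<dots> = (\<Sum>j\<in>e ` {..<M}. spike j t)" using inj by (simp add: sum.reindex)
  also have "\<dots> \<le> slope t"
    unfolding slope_def by (rule sum_le_suminf[OF sum]) (auto intro: spike_nonneg)
  finally show ?thesis .
qed

text \<open>The last factor is the width of the spike with index \<open>K * (2 * M + 1) - 1\<close>, of order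
\<open>exp (- const * M\<^sup>2)\<close>. The double exponential exceeds every exponential of a power of \<open>M\<close>, because \<open>exp ((c * ln M)\<^sup>2) = M powr (c\<^sup>2 * ln M)\<close>.\<close>

lemma blow_up_rate:
  fixes c K :: real
  assumes "c > 0" "K > 0" "\<eta> > 0"
  shows "filterlim (\<lambda>M. \<eta> * exp (exp ((c * ln (real M + 1) - C)\<^sup>2))
     * exp (- (ln 2 * ((K * (2 * real M + 1) - 1) * (K * (2 * real M + 1) + 8))))) at_top sequentially"
  using assms by real_asymp

text \<open>It suffices to integrate over the neighbourhoods of one rational point in the interval that the previous lemmas provide. The
constant \<open>C\<close> leaves room for the bounded derivative of a Lipschitz perturbation.\<close>

lemma nn_integral_blow_up:
  fixes h :: "real \<Rightarrow> real"
  assumes pq: "p < q" and \<eta>: "\<eta> > 0"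
    and h: "AE t in lborel. t \<in> {p<..<q} \<longrightarrow> slope t - C \<le> h t"
  shows "(\<integral>\<^sup>+t. ennreal (\<eta> * exp (exp ((h t)\<^sup>2))) * indicator {p<..<q} t \<partial>lborel) = \<infinity>"
proof -
  obtain r where r: "p < real_of_rat r" "real_of_rat r < q"
    using of_rat_dense[OF pq] by auto
  obtain i where i: "r = nat_to_rat_surj i" using surj_nat_to_rat_surj by (metis surjD)
  define x where "x = real_of_rat r"
  define c :: real where "c = (1/2) ^ (i + 2)"
  define e where "e M = 2 ^ i * (2 * M + 1) - (1::nat)" for M
  have c: "c > 0" by (simp add: c_def)
  let ?I = "\<integral>\<^sup>+t. ennreal (\<eta> * exp (exp ((h t)\<^sup>2))) * indicator {p<..<q} t \<partial>lborel"
  let ?R = "\<lambda>M. \<eta> * exp (exp ((c * ln (real M + 1) - C)\<^sup>2)) * width (e M)"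
  have width_e: "width (e M) = exp (- (ln 2 * ((2 ^ i * (2 * real M + 1) - 1) * (2 ^ i * (2 * real M + 1) + 8))))" for M
  proof -
    have e1: "real (e M) = 2 ^ i * (2 * real M + 1) - 1"
    proof -
      have "1 \<le> 2 ^ i * (2 * M + 1)" by (simp add: Suc_le_eq)
      then have "real (e M) = real (2 ^ i * (2 * M + 1)) - real 1"
        unfolding e_def by (rule of_nat_diff)
      also have "real (2 ^ i * (2 * M + 1)) = 2 ^ i * (2 * real M + 1)"
        by (simp only: of_nat_mult of_nat_add of_nat_power of_nat_numeral of_nat_1)
      finally show ?thesis by simp
    qed
    have "exp (- ln 2) = (1/2::real)" by (simp add: exp_minus)
    then have "width (e M) = exp (- ln 2) ^ (e M * (e M + 9))" by (simp only: width_def)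
    also have "\<dots> = exp (real (e M * (e M + 9)) * - ln 2)" by (rule exp_of_nat_mult[symmetric])
    also have "real (e M * (e M + 9)) * - ln 2 = - (ln 2 * real (e M * (e M + 9)))" by simp
    also have "real (e M * (e M + 9)) = real (e M) * (real (e M) + 9)" by simp
    finally show ?thesis unfolding e1 by (simp add: add_ac)
  qed
  have lim: "filterlim ?R at_top sequentially"
    unfolding width_e using c \<eta> by (intro blow_up_rate) auto
  have wlim: "(\<lambda>M. width (e M)) \<longlonglongrightarrow> 0"
  proof (rule tendsto_sandwich[OF _ _ tendsto_const])
    show "(\<lambda>M. (1/2::real) ^ M) \<longlonglongrightarrow> 0" by (intro LIMSEQ_power_zero) auto
    have "M \<le> e M * (e M + 9)" for M
    proof -
      have "1 * (2 * M + 1) \<le> 2 ^ i * (2 * M + 1)" by (intro mult_right_mono) auto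
      then have "M \<le> e M" by (simp add: e_def)
      also have "e M * 1 \<le> e M * (e M + 9)" by (intro mult_left_mono) auto
      finally show ?thesis by simp
    qed
    then show "\<forall>\<^sub>F M in sequentially. width (e M) \<le> (1/2) ^ M"
      unfolding width_def by (intro always_eventually allI power_decreasing) auto
  qed (simp add: less_imp_le[OF width_pos])
  have large: "ennreal R \<le> ?I" for R :: real
  proof -
    (* M is chosen so large that the M-th spike at x lies inside the interval and the lower bound for h
       on it is nonnegative, so that it may be squared. *)
    have "\<forall>\<^sub>F M in sequentially. R \<le> ?R M" using lim by (simp add: filterlim_at_top)
    moreover have "\<forall>\<^sub>F M in sequentially. width (e M) < min (x - p) (q - x)"
      by (rule order_tendstoD[OF wlim]) (use r in \<open>auto simp: x_def\<close>)
    moreover have "filterlim (\<lambda>M. c * ln (real M + 1) - C) at_top sequentially"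
      using c by real_asymp
    then have "\<forall>\<^sub>F M in sequentially. 0 \<le> c * ln (real M + 1) - C"
      unfolding filterlim_at_top by blast
    ultimately have "\<forall>\<^sub>F M in sequentially. R \<le> ?R M \<and> width (e M) < min (x - p) (q - x) \<and> 0 \<le> c * ln (real M + 1) - C"
      by eventually_elim simp
    then obtain M where M: "R \<le> ?R M" "width (e M) < min (x - p) (q - x)" "0 \<le> c * ln (real M + 1) - C"
      using eventually_happens'[OF sequentially_bot] by blast
    let ?J = "{x - width (e M) / 2..x + width (e M) / 2}"
    let ?v = "\<eta> * exp (exp ((c * ln (real M + 1) - C)\<^sup>2))"
    have "ennreal R \<le> ennreal (?v * width (e M))" using M(1) by (rule ennreal_leI)
    also have "\<dots> = (\<integral>\<^sup>+t. ennreal ?v * indicator ?J t \<partial>lborel)"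
      using width_pos[of "e M"] \<eta> by (simp add: nn_integral_cmult_indicator ennreal_mult)
    also have "\<dots> \<le> ?I"
    proof (rule nn_integral_mono_AE)
      show "AE t in lborel. ennreal ?v * indicator ?J t \<le> ennreal (\<eta> * exp (exp ((h t)\<^sup>2))) * indicator {p<..<q} t"
        using h AE_summable_spike
      proof eventually_elim
        case (elim t)
        show ?case
        proof (cases "t \<in> ?J")
          case True
          then have "t \<in> {p<..<q}" using M(2) width_pos[of "e M"] by auto
          moreover have "\<bar>t - real_of_rat (nat_to_rat_surj i)\<bar> \<le> width (2 ^ i * (2 * M + 1) - 1) / 2"
            unfolding e_def[symmetric] i[symmetric] x_def[symmetric] using True
            by (simp only: atLeastAtMost_iff) linarith
          then have "c * ln (real M + 1) \<le> slope t"
            unfolding c_def by (rule slope_ge_near_centre[OF elim(2)])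
          ultimately have "c * ln (real M + 1) - C \<le> h t" using elim(1) by auto
          then have "(c * ln (real M + 1) - C)\<^sup>2 \<le> (h t)\<^sup>2" using M(3) by (intro power_mono) auto
          then have "?v \<le> \<eta> * exp (exp ((h t)\<^sup>2))" using \<eta> by simp
          then show ?thesis using True \<open>t \<in> {p<..<q}\<close> by (simp add: ennreal_leI)
        qed simp
      qed
    qed
    finally show ?thesis .
  qed
  show ?thesis
  proof (rule ccontr)
    assume "?I \<noteq> \<infinity>"
    then obtain y where y: "?I = ennreal y" "y \<ge> 0" by (cases ?I) auto
    show False using large[of "y + 1"] y by simp
  qed
qed

section \<open>The Lagrangian\<close>

definition minimizer :: "real \<Rightarrow> real" where
  "minimizer x = (LINT t:{-1<..<x}|lebesgue. slope t)"

definition lagrangian :: "real \<Rightarrow> real \<Rightarrow> real \<Rightarrow> real" where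
  "lagrangian t y p = p\<^sup>2 + \<bar>y - minimizer t\<bar> * exp (exp (p\<^sup>2)) + total_penalty (y - minimizer t)"

lemma is_primitive_minimizer: "is_primitive (-1) 1 minimizer slope"
  unfolding is_primitive_def
proof (intro conjI ballI)
  show "set_integrable lebesgue {-1<..<1} slope"
    by (rule set_integrable_lebesgue_if_lborel[OF integrable_slope]) simp
  fix x :: real
  show "minimizer x = minimizer (-1) + (LINT t:{-1<..<x}|lebesgue. slope t)"
    by (simp add: minimizer_def set_lebesgue_integral_def)
qed

lemma set_integrable_slope_square: "set_integrable lebesgue {-1<..<1} (\<lambda>t. (slope t)\<^sup>2)"
  by (rule set_integrable_lebesgue_if_lborel[OF integrable_slope_square]) simp

lemma lagrangian_ge: "p\<^sup>2 + total_penalty (y - minimizer t) \<le> lagrangian t y p"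
  by (simp add: lagrangian_def)

lemma lagrangian_ge_square: "p\<^sup>2 \<le> lagrangian t y p"
  using lagrangian_ge[of p y t] total_penalty_nonneg[of "y - minimizer t"] by linarith

lemma minimizer_sobolev_2: "minimizer \<in> sobolev 2 (-1) 1"
proof (rule sobolev_if_is_primitive[OF _ is_primitive_minimizer])
  have "set_integrable lebesgue {-1<..<1} slope"
    using is_primitive_minimizer by (simp add: is_primitive_def)
  then show "Lp_on 2 {-1<..<1} slope"
    using set_integrable_slope_square
    by (auto simp: Lp_on_def abs_powr_2 set_borel_measurable_def set_integrable_def)
qed auto

lemma energy_minimizer:
  "energy lagrangian 1 minimizer = ennreal (LINT t:{-1<..<1}|lebesgue. (slope t)\<^sup>2)"
proof -
  have "energy lagrangian 1 minimizer
      = (\<integral>\<^sup>+t\<in>{-1<..<1}. ennreal (lagrangian t (minimizer t) (slope t)) \<partial>lebesgue)"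
    using energy_if_is_primitive[OF _ is_primitive_minimizer] by simp
  also have "\<dots> = (\<integral>\<^sup>+t\<in>{-1<..<1}. ennreal ((slope t)\<^sup>2) \<partial>lebesgue)"
    by (simp add: lagrangian_def total_penalty_0)
  also have "\<dots> = ennreal (LINT t:{-1<..<1}|lebesgue. (slope t)\<^sup>2)"
    by (rule set_nn_integral_eq_set_integral[OF set_integrable_slope_square]) simp
  finally show ?thesis .
qed

lemma continuous_on_lagrangian:
  "continuous_on ({-1..1} \<times> UNIV \<times> UNIV) (\<lambda>(t, y, p). lagrangian t y p)"
proof -
  have m: "continuous_on ({-1..1} \<times> UNIV \<times> UNIV) (\<lambda>z::real \<times> real \<times> real. minimizer (fst z))"
  proof (rule continuous_on_compose2[OF is_primitive_continuous[OF is_primitive_minimizer]])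
    show "continuous_on ({-1..1} \<times> UNIV \<times> UNIV) (fst :: real \<times> real \<times> real \<Rightarrow> real)"
      by (intro continuous_on_fst continuous_on_id)
  qed (simp add: image_subset_iff)
  have "continuous_on ({-1..1} \<times> UNIV \<times> UNIV)
      (\<lambda>z::real \<times> real \<times> real. total_penalty (fst (snd z) - minimizer (fst z)))"
    by (rule continuous_on_compose2[OF continuous_on_total_penalty]) (intro continuous_intros m, simp)
  then show ?thesis
    unfolding lagrangian_def case_prod_beta by (intro continuous_intros m)
qed

lemma superlinear_lagrangian: "superlinear lagrangian 1"
  unfolding superlinear_def
proof (intro exI[of _ "\<lambda>p. p\<^sup>2"] conjI ballI allI)
  have "\<bar>p\<bar>\<^sup>2 / \<bar>p\<bar> = norm p" for p :: real
    by (cases "p = 0") (auto simp: power2_eq_square abs_if)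
  then show "filterlim (\<lambda>p::real. \<bar>p\<bar>\<^sup>2 / \<bar>p\<bar>) at_top at_infinity"
    using filterlim_norm_at_top[where 'a=real] by (simp only:)
  show "\<bar>p\<bar>\<^sup>2 \<le> lagrangian t y p" for t y p
    using lagrangian_ge_square by simp
qed

text \<open>The function \<open>exp (exp (p\<^sup>2))\<close> is convex, so the quadratic term alone bounds the second derivative from below.\<close>

lemma Lpp_lagrangian: "Lpp_at_least lagrangian 1 2"
  unfolding Lpp_at_least_def
proof (intro ballI allI)
  fix t y p :: real
  define A where "A = \<bar>y - minimizer t\<bar>"
  define B where "B = total_penalty (y - minimizer t)"
  define L1 where "L1 q = 2 * q + A * (exp (exp (q\<^sup>2)) * (exp (q\<^sup>2) * (2 * q)))" for q :: real
  define L2 where "L2 q = 2 + A * (exp (exp (q\<^sup>2)) * exp (q\<^sup>2) * (2 + 4 * q\<^sup>2 + 4 * q\<^sup>2 * exp (q\<^sup>2)))" for q :: real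
  have L: "lagrangian t y = (\<lambda>q. q\<^sup>2 + A * exp (exp (q\<^sup>2)) + B)"
    by (simp add: lagrangian_def A_def B_def fun_eq_iff)
  have d1: "(lagrangian t y has_real_derivative L1 q) (at q)" for q
    unfolding L L1_def by (auto intro!: derivative_eq_intros)
  then have deriv1: "deriv (lagrangian t y) = L1" by (auto intro!: ext DERIV_imp_deriv)
  have d2: "(L1 has_real_derivative L2 q) (at q)" for q
    unfolding L1_def[abs_def] L2_def by (auto intro!: derivative_eq_intros simp: power2_eq_square algebra_simps)
  have "0 \<le> A * (exp (exp (p\<^sup>2)) * exp (p\<^sup>2) * (2 + 4 * p\<^sup>2 + 4 * p\<^sup>2 * exp (p\<^sup>2)))"
    unfolding A_def by (intro mult_nonneg_nonneg add_nonneg_nonneg) auto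
  then have "2 \<le> L2 p" by (simp add: L2_def)
  then show "lagrangian t y differentiable at p \<and> deriv (lagrangian t y) differentiable at p \<and>
      2 \<le> deriv (deriv (lagrangian t y)) p"
    unfolding deriv1 using d1[of p] d2[of p] DERIV_imp_deriv[OF d2[of p]]
    by (auto simp: real_differentiable_def)
qed

text \<open>A competitor \<open>u\<close> of finite energy has a square integrable derivative \<open>f\<close>. Expanding \<open>f\<^sup>2\<close> around the slope, the
difference of the energies is at least the quantity of \<open>slope_compensated\<close> for \<open>v = u - minimizer\<close>.\<close>

lemma minimizer_over_lagrangian:
  "minimizer_over lagrangian 1 (minimizer (-1)) (minimizer 1) minimizer"
  unfolding minimizer_over_def
proof (intro conjI ballI)
  have "set_integrable lebesgue {-1<..<1} slope"
    using is_primitive_minimizer by (simp add: is_primitive_def)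
  then show "minimizer \<in> admissible 1 (minimizer (-1)) (minimizer 1)"
    unfolding admissible_def
    using sobolev_if_is_primitive[OF _ is_primitive_minimizer, of 1] by (simp add: Lp_on_1_iff)
  fix u assume "u \<in> admissible 1 (minimizer (-1)) (minimizer 1)"
  then have u: "u \<in> sobolev 1 (-1) 1" "u (-1) = minimizer (-1)" "u 1 = minimizer 1"
    by (auto simp: admissible_def)
  obtain f where f: "is_primitive (-1) 1 u f"
    using is_primitive_if_sobolev_1[OF _ u(1)] by auto
  have eu: "energy lagrangian 1 u = (\<integral>\<^sup>+t\<in>{-1<..<1}. ennreal (lagrangian t (u t) (f t)) \<partial>lebesgue)"
    using energy_if_is_primitive[OF _ f] by simp
  show "energy lagrangian 1 minimizer \<le> energy lagrangian 1 u"
  proof (cases "energy lagrangian 1 u = \<infinity>")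
    case False
    let ?S = "{-1<..<1::real}"
    let ?w = minimizer
    have fi: "set_integrable lebesgue ?S f" using f by (simp add: is_primitive_def)
    have f_meas: "(\<lambda>x. indicator ?S x * f x) \<in> borel_measurable lebesgue"
      using fi by (auto simp: set_integrable_def)
    have f2_meas: "(\<lambda>x. indicator ?S x * (f x)\<^sup>2) \<in> borel_measurable lebesgue"
    proof -
      have "(\<lambda>x. indicator ?S x * (f x)\<^sup>2) = (\<lambda>x. (indicator ?S x * f x)\<^sup>2)"
        by (auto split: split_indicator)
      then show ?thesis using borel_measurable_power[OF f_meas, of 2] by simp
    qed
    have f2: "set_integrable lebesgue ?S (\<lambda>x. (f x)\<^sup>2)"
      unfolding set_integrable_def real_scaleR_def
    proof (rule integrableI_nonneg[OF f2_meas])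
      have "(\<integral>\<^sup>+x. ennreal (indicator ?S x * (f x)\<^sup>2) \<partial>lebesgue) \<le> energy lagrangian 1 u"
        unfolding eu using lagrangian_ge_square
        by (intro nn_integral_mono) (auto split: split_indicator intro: ennreal_leI)
      then show "(\<integral>\<^sup>+x. ennreal (indicator ?S x * (f x)\<^sup>2) \<partial>lebesgue) < \<infinity>"
        using False by (auto simp: top.not_eq_extremum)
    qed simp
    have si: "set_integrable lebesgue ?S slope"
      using is_primitive_minimizer by (simp add: is_primitive_def)
    have d: "is_primitive (-1) 1 (\<lambda>x. u x - ?w x) (\<lambda>x. f x - slope x)"
      by (rule is_primitive_combine(2)[OF f is_primitive_minimizer])
    have d_meas: "(\<lambda>x. indicator ?S x * (f x - slope x)) \<in> borel_measurable lebesgue"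
      using d by (auto simp: set_integrable_def is_primitive_def)
    have d2: "set_integrable lebesgue ?S (\<lambda>x. (f x - slope x)\<^sup>2)"
      unfolding set_integrable_def real_scaleR_def
    proof (rule Bochner_Integration.integrable_bound)
      show "integrable lebesgue (\<lambda>x. indicator ?S x *\<^sub>R (2 * (f x)\<^sup>2 + 2 * (slope x)\<^sup>2))"
        using set_integral_add(1)[OF set_integrable_mult_right set_integrable_mult_right, OF f2 set_integrable_slope_square]
        unfolding set_integrable_def .
      have "(\<lambda>x. indicator ?S x * (f x - slope x)\<^sup>2) = (\<lambda>x. (indicator ?S x * (f x - slope x))\<^sup>2)"
        by (auto split: split_indicator)
      then show "(\<lambda>x. indicator ?S x * (f x - slope x)\<^sup>2) \<in> borel_measurable lebesgue"
        using borel_measurable_power[OF d_meas, of 2] by simp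
      have "(a - b)\<^sup>2 \<le> 2 * a\<^sup>2 + 2 * b\<^sup>2" for a b :: real
        using zero_le_power2[of "a + b"] by (simp add: power2_eq_square algebra_simps)
      then show "AE x in lebesgue. norm (indicator ?S x * (f x - slope x)\<^sup>2)
          \<le> norm (indicator ?S x *\<^sub>R (2 * (f x)\<^sup>2 + 2 * (slope x)\<^sup>2))"
        by (intro AE_I2) (simp split: split_indicator)
    qed
    have \<Phi>: "set_integrable lebesgue ?S (\<lambda>x. total_penalty (u x - ?w x))"
      by (intro set_integrable_lebesgue_continuous
          continuous_on_compose2[OF continuous_on_total_penalty is_primitive_continuous[OF d]]) auto
    have ds: "set_integrable lebesgue ?S (\<lambda>x. (f x - slope x) * slope x)"
      and ineq: "0 \<le> 2 * (LINT x:?S|lebesgue. (f x - slope x) * slope x)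
        + (LINT x:?S|lebesgue. (f x - slope x)\<^sup>2) + (LINT x:?S|lebesgue. total_penalty (u x - ?w x))"
      using slope_compensated[OF _ d _ _ d2] u by simp_all
    have "(LINT x:?S|lebesgue. (f x)\<^sup>2) = (LINT x:?S|lebesgue. (slope x)\<^sup>2
        + (2 * ((f x - slope x) * slope x) + (f x - slope x)\<^sup>2))"
      by (intro arg_cong[where f="set_lebesgue_integral lebesgue ?S"] ext)
        (simp add: power2_eq_square algebra_simps)
    also have "\<dots> = (LINT x:?S|lebesgue. (slope x)\<^sup>2)
        + (2 * (LINT x:?S|lebesgue. (f x - slope x) * slope x) + (LINT x:?S|lebesgue. (f x - slope x)\<^sup>2))"
      using ds d2 set_integrable_slope_square by (simp add: set_integral_add set_integrable_mult_right)
    finally have "(LINT x:?S|lebesgue. (slope x)\<^sup>2)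
        \<le> (LINT x:?S|lebesgue. (f x)\<^sup>2) + (LINT x:?S|lebesgue. total_penalty (u x - ?w x))"
      using ineq by linarith
    also have "\<dots> = (LINT x:?S|lebesgue. (f x)\<^sup>2 + total_penalty (u x - ?w x))"
      by (rule set_integral_add(2)[OF f2 \<Phi>, symmetric])
    finally have "energy lagrangian 1 minimizer
        \<le> ennreal (LINT x:?S|lebesgue. (f x)\<^sup>2 + total_penalty (u x - ?w x))"
      unfolding energy_minimizer by (rule ennreal_leI)
    also have "\<dots> = (\<integral>\<^sup>+x\<in>?S. ennreal ((f x)\<^sup>2 + total_penalty (u x - ?w x)) \<partial>lebesgue)"
      by (rule set_nn_integral_eq_set_integral[symmetric, OF set_integral_add(1)[OF f2 \<Phi>]])
        (simp add: total_penalty_nonneg)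
    also have "\<dots> \<le> energy lagrangian 1 u"
      unfolding eu using lagrangian_ge
      by (intro nn_integral_mono mult_right_mono ennreal_leI) auto
    finally show ?thesis .
  qed simp
qed

lemma energy_lipschitz_perturbation:
  assumes u: "u \<in> lipschitz_zero (-1) 1" and t: "t \<in> {-1..1}" "u t \<noteq> 0"
  shows "energy lagrangian 1 (\<lambda>t. minimizer t + u t) = \<infinity>"
proof -
  obtain C where C: "C-lipschitz_on {-1..1} u" and u0: "u (-1) = 0" "u 1 = 0"
    using u by (auto simp: lipschitz_zero_def)
  obtain d where d: "is_primitive (-1) 1 u d" and d_le: "AE x in lborel. x \<in> {-1<..<1} \<longrightarrow> \<bar>d x\<bar> \<le> C"
    using is_primitive_if_lipschitz[OF _ C] by auto
  have sum: "is_primitive (-1) 1 (\<lambda>t. minimizer t + u t) (\<lambda>t. slope t + d t)"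
    by (rule is_primitive_combine(1)[OF is_primitive_minimizer d])
  have "t \<noteq> -1" "t \<noteq> 1" using t u0 by auto
  then have t_in: "t \<in> {-1<..<1}" using t by auto
  define \<eta> where "\<eta> = \<bar>u t\<bar> / 2"
  have \<eta>: "\<eta> > 0" using t by (simp add: \<eta>_def)
  have "continuous_on {-1<..<1} u"
    by (rule continuous_on_subset[OF is_primitive_continuous[OF d]]) auto
  then have "isCont u t" using t_in by (simp add: continuous_on_eq_continuous_at)
  then have "((\<lambda>x. \<bar>u x\<bar>) \<longlongrightarrow> \<bar>u t\<bar>) (at t)" by (simp add: isCont_def tendsto_rabs)
  then have "\<forall>\<^sub>F x in at t. \<eta> < \<bar>u x\<bar>" by (rule order_tendstoD) (use \<eta> in \<open>simp add: \<eta>_def\<close>)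
  then obtain e where e: "e > 0" "\<And>x. x \<noteq> t \<Longrightarrow> dist x t < e \<Longrightarrow> \<eta> < \<bar>u x\<bar>"
    by (auto simp: eventually_at)
  define p where "p = max (-1) (t - e)"
  define q where "q = min 1 (t + e)"
  have pq: "p < q" "{p<..<q} \<subseteq> {-1<..<1}" using t_in e by (auto simp: p_def q_def)
  have u_ge: "\<eta> \<le> \<bar>u x\<bar>" if "x \<in> {p<..<q}" for x
  proof (cases "x = t")
    case False
    have "dist x t < e" using that by (auto simp: p_def q_def dist_real_def)
    then show ?thesis using e(2)[OF False] by simp
  qed (use \<eta> in \<open>simp add: \<eta>_def\<close>)
  have "(\<integral>\<^sup>+x. ennreal (\<eta> * exp (exp ((slope x + d x)\<^sup>2))) * indicator {p<..<q} x \<partial>lborel) = \<infinity>"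
  proof (rule nn_integral_blow_up[OF pq(1) \<eta>])
    show "AE x in lborel. x \<in> {p<..<q} \<longrightarrow> slope x - C \<le> slope x + d x"
      using d_le by eventually_elim (use pq in \<open>auto simp: abs_le_iff\<close>)
  qed
  moreover have "(\<integral>\<^sup>+x. ennreal (\<eta> * exp (exp ((slope x + d x)\<^sup>2))) * indicator {p<..<q} x \<partial>lborel)
      \<le> (\<integral>\<^sup>+x\<in>{-1<..<1}. ennreal (lagrangian x (minimizer x + u x) (slope x + d x)) \<partial>lborel)"
  proof (rule nn_integral_mono)
    fix x
    show "ennreal (\<eta> * exp (exp ((slope x + d x)\<^sup>2))) * indicator {p<..<q} x
        \<le> ennreal (lagrangian x (minimizer x + u x) (slope x + d x)) * indicator {-1<..<1} x"
    proof (cases "x \<in> {p<..<q}")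
      case True
      have "\<eta> * exp (exp ((slope x + d x)\<^sup>2)) \<le> \<bar>u x\<bar> * exp (exp ((slope x + d x)\<^sup>2))"
        using u_ge[OF True] by (intro mult_right_mono) auto
      also have "\<dots> \<le> lagrangian x (minimizer x + u x) (slope x + d x)"
        using total_penalty_nonneg[of "u x"] by (simp add: lagrangian_def)
      finally have "\<eta> * exp (exp ((slope x + d x)\<^sup>2)) \<le> lagrangian x (minimizer x + u x) (slope x + d x)" .
      moreover have "x \<in> {-1<..<1}" using True pq(2) by blast
      ultimately show ?thesis using True by (simp add: ennreal_leI)
    qed simp
  qed
  moreover have "energy lagrangian 1 (\<lambda>t. minimizer t + u t)
      = (\<integral>\<^sup>+x\<in>{-1<..<1}. ennreal (lagrangian x (minimizer x + u x) (slope x + d x)) \<partial>lborel)"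
    using energy_if_is_primitive[OF _ sum] by (simp add: nn_integral_completion)
  ultimately show ?thesis by (simp add: top.extremum_unique)
qed

theorem theorem18:
  shows "\<exists>(T::real) (w :: real \<Rightarrow> real) (L :: real \<Rightarrow> real \<Rightarrow> real \<Rightarrow> real).
    T > 0 \<and>
    w \<in> sobolev 2 (-T) T \<and>
    continuous_on ({-T..T} \<times> UNIV \<times> UNIV) (\<lambda>(t, y, p). L t y p) \<and>
    (\<forall>t\<in>{-T..T}. \<forall>y p. L t y p \<ge> 0) \<and>
    superlinear L T \<and>
    Lpp_at_least L T 2 \<and>
    minimizer_over L T (w (-T)) (w T) w \<and>
    0 \<le> energy L T w \<and> energy L T w < \<infinity> \<and>
    (\<forall>u \<in> lipschitz_zero (-T) T.
       (\<exists>t\<in>{-T..T}. u t \<noteq> 0) \<longrightarrow> energy L T (\<lambda>t. w t + u t) = \<infinity>)"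
proof (intro exI[of _ "1::real"] exI[of _ minimizer] exI[of _ lagrangian] conjI)
  show "\<forall>t\<in>{-1..1}. \<forall>y p. 0 \<le> lagrangian t y p"
    using lagrangian_ge_square by (meson order_trans zero_le_power2)
  show "continuous_on ({-1..1} \<times> UNIV \<times> UNIV) (\<lambda>(t, y, p). lagrangian t y p)"
    by (rule continuous_on_lagrangian)
  show "energy lagrangian 1 minimizer < \<infinity>" by (simp add: energy_minimizer)
  show "\<forall>u\<in>lipschitz_zero (-1) 1. (\<exists>t\<in>{-1..1}. u t \<noteq> 0) \<longrightarrow>
      energy lagrangian 1 (\<lambda>t. minimizer t + u t) = \<infinity>"
    using energy_lipschitz_perturbation by blast
qed (simp_all add: minimizer_sobolev_2 superlinear_lagrangian
    Lpp_lagrangian minimizer_over_lagrangian)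

end
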